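(* Let $p\ge19$ be prime, $0<\alpha<1$, and $\alpha^{e^{-132}}\le\beta\le\min(p^{-\log p},p^{-100})$. Then there exist $n\ge\mathrm{Tow}\!\left(p,\tfrac{1}{20}(\log p)\ln\!\big(\tfrac{\log(1/\alpha)}{\log(1/\beta)}\big),1/\beta\right)$ and a function $f:\mathbb{F}_p^n\to[0,1]$ with $\mathbb{E}_{x}[f(x)]=\alpha$ such that for every nonzero $d\in\mathbb{F}_p^n$, $\mathbb{E}_{x\in\mathbb{F}_p^n}[f(x)f(x+d)f(x+2d)]<\beta\alpha^3$.
   Context: $\mathrm{Tow}(a,0,r)=r$, $\mathrm{Tow}(a,k+1,r)=a^{\mathrm{Tow}(a,k,r)}$, non-integer heights rounded down. $\log$ is base 2, $\ln$ natural. *)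

theory Defs
  imports Complex_Main "HOL-Computational_Algebra.Primes"
begin

fun Tow :: "real \<Rightarrow> nat \<Rightarrow> real \<Rightarrow> real" where
  "Tow a 0 r = r"
| "Tow a (Suc k) r = a powr (Tow a k r)"

text \<open>Tower with a real height, rounded down (negative heights give height 0).\<close>
definition TowR :: "real \<Rightarrow> real \<Rightarrow> real \<Rightarrow> real" where
  "TowR a h r = Tow a (nat \<lfloor>h\<rfloor>) r"

definition Fpn :: "nat \<Rightarrow> nat \<Rightarrow> nat list set" where
  "Fpn p n = {xs. length xs = n \<and> (\<forall>a\<in>set xs. a < p)}"

definition vadd :: "nat \<Rightarrow> nat list \<Rightarrow> nat list \<Rightarrow> nat list" where
  "vadd p x y = map2 (\<lambda>a b. (a + b) mod p) x y"

definition avg :: "nat \<Rightarrow> nat \<Rightarrow> (nat list \<Rightarrow> real) \<Rightarrow> real" where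
  "avg p n g = (\<Sum>x\<in>Fpn p n. g x) / real p ^ n"

end

(*
  The function is a multiple of the indicator of a set A of density at least alpha in which, for
  every nonzero d, the progressions with difference d have density below beta times the cube of
  the density of A. Such sets are built recursively. Given A in F_p^n, attach to each x in A a
  random linear map v_x from F_p^N to F_p^m and take all (x, y) with x in A and v_x y in B, where
  B is a progression-free set in F_p^m: the points of a sphere with digits at most (p-1)/2, which
  has density about 2^-m. For a difference (d1, d2) with d1 nonzero, any three of the maps are
  jointly surjective, so the relative count does not change. For d1 = 0 only those x with
  v_x d2 = 0 contribute, a fraction of at most 4 p^-m, and this is harmless as soon as
  4 p^-m <= beta (density of the new set)^2. Chernoff's bound permits N to be exponential in n.

  One step replaces L, the binary logarithm of the inverse density, by L (1 + 5 / log p), because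
  m of size 4 L / log p suffices. So about (log p) ln(L_alpha / L_beta) / 5 steps are available
  before the density drops below alpha, while the dimension gains one exponential per step.
*)
theory Submission
  imports Defs "HOL-Library.FuncSet"
begin

section \<open>Coordinatewise arithmetic in F_p^n on lists of residues\<close>

definition vneg :: "nat \<Rightarrow> nat list \<Rightarrow> nat list" where
  "vneg p x = map (\<lambda>a. (p - a) mod p) x"

definition vscale :: "nat \<Rightarrow> nat \<Rightarrow> nat list \<Rightarrow> nat list" where
  "vscale p a x = map (\<lambda>b. (a * b) mod p) x"

definition dens :: "nat \<Rightarrow> nat \<Rightarrow> nat list set \<Rightarrow> real" where
  "dens p n A = real (card A) / real p ^ n"

definition aps :: "nat \<Rightarrow> nat list set \<Rightarrow> nat list \<Rightarrow> nat list set" where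
  "aps p A d = {x \<in> A. vadd p x d \<in> A \<and> vadd p x (vadd p d d) \<in> A}"

lemma Fpn_eq_lists: "Fpn p n = {xs. set xs \<subseteq> {..<p} \<and> length xs = n}"
  by (auto simp: Fpn_def)

lemma finite_Fpn [simp]: "finite (Fpn p n)"
  unfolding Fpn_eq_lists by (rule finite_lists_length_eq) simp

lemma card_Fpn [simp]: "card (Fpn p n) = p ^ n"
  unfolding Fpn_eq_lists by (subst card_lists_length_eq) simp_all

lemma Fpn_length: "x \<in> Fpn p n \<Longrightarrow> length x = n"
  by (simp add: Fpn_def)

lemma Fpn_nth: "x \<in> Fpn p n \<Longrightarrow> i < n \<Longrightarrow> x ! i < p"
  by (auto simp: Fpn_def)

lemma FpnI: "length x = n \<Longrightarrow> (\<And>i. i < n \<Longrightarrow> x ! i < p) \<Longrightarrow> x \<in> Fpn p n"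
  by (auto simp: Fpn_def in_set_conv_nth)

lemma Fpn_0 [simp]: "Fpn p 0 = {[]}"
  by (auto simp: Fpn_def)

lemma Fpn_Suc: "Fpn p (Suc n) = (\<lambda>(a, x). a # x) ` ({..<p} \<times> Fpn p n)"
proof (intro equalityI subsetI)
  fix z assume "z \<in> Fpn p (Suc n)"
  then show "z \<in> (\<lambda>(a, x). a # x) ` ({..<p} \<times> Fpn p n)"
    by (cases z) (auto simp: Fpn_def)
qed (auto simp: Fpn_def)

lemma zero_in_Fpn [simp]: "0 < p \<Longrightarrow> replicate n 0 \<in> Fpn p n"
  by (simp add: Fpn_def)

lemma length_vadd [simp]: "length (vadd p x y) = min (length x) (length y)"
  by (simp add: vadd_def)

lemma nth_vadd [simp]:
  "i < length x \<Longrightarrow> i < length y \<Longrightarrow> vadd p x y ! i = (x ! i + y ! i) mod p"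
  by (simp add: vadd_def)

lemma length_vneg [simp]: "length (vneg p x) = length x"
  by (simp add: vneg_def)

lemma nth_vneg [simp]: "i < length x \<Longrightarrow> vneg p x ! i = (p - x ! i) mod p"
  by (simp add: vneg_def)

lemma length_vscale [simp]: "length (vscale p a x) = length x"
  by (simp add: vscale_def)

lemma nth_vscale [simp]: "i < length x \<Longrightarrow> vscale p a x ! i = (a * x ! i) mod p"
  by (simp add: vscale_def)

lemma vadd_closed [simp]:
  "0 < p \<Longrightarrow> x \<in> Fpn p n \<Longrightarrow> y \<in> Fpn p n \<Longrightarrow> vadd p x y \<in> Fpn p n"
  by (rule FpnI) (auto simp: Fpn_length)

lemma vneg_closed [simp]: "0 < p \<Longrightarrow> x \<in> Fpn p n \<Longrightarrow> vneg p x \<in> Fpn p n"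
  by (rule FpnI) (auto simp: Fpn_length)

lemma vscale_closed [simp]: "0 < p \<Longrightarrow> x \<in> Fpn p n \<Longrightarrow> vscale p a x \<in> Fpn p n"
  by (rule FpnI) (auto simp: Fpn_length)

lemma vadd_commute: "vadd p x y = vadd p y x"
  by (rule nth_equalityI) (auto simp: add.commute)

lemma vadd_assoc: "vadd p (vadd p x y) z = vadd p x (vadd p y z)"
  by (rule nth_equalityI) (auto simp: mod_add_left_eq mod_add_right_eq add.assoc)

lemma vadd_left_commute: "vadd p x (vadd p y z) = vadd p y (vadd p x z)"
  by (metis vadd_assoc vadd_commute)

lemmas vadd_ac = vadd_assoc vadd_commute vadd_left_commute

lemma vadd_zero: "x \<in> Fpn p n \<Longrightarrow> vadd p (replicate n 0) x = x"
  by (rule nth_equalityI) (auto simp: Fpn_length Fpn_nth)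

lemma vadd_zero_right: "x \<in> Fpn p n \<Longrightarrow> vadd p x (replicate n 0) = x"
  by (metis vadd_commute vadd_zero)

lemma vadd_vneg: "x \<in> Fpn p n \<Longrightarrow> vadd p x (vneg p x) = replicate n 0"
  by (rule nth_equalityI) (auto simp: Fpn_length mod_add_right_eq less_imp_le[OF Fpn_nth])

lemma vadd_left_cancel:
  assumes "x \<in> Fpn p n" "y \<in> Fpn p n" "z \<in> Fpn p n" "vadd p x y = vadd p x z"
  shows "y = z"
proof -
  have "vadd p (vneg p x) (vadd p x y) = vadd p (vneg p x) (vadd p x z)"
    using assms by simp
  moreover have "vadd p (vneg p x) (vadd p x w) = w" if "w \<in> Fpn p n" for w
    using vadd_vneg[OF assms(1)] vadd_zero[OF that] by (metis vadd_assoc vadd_commute)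
  ultimately show ?thesis using assms(2,3) by metis
qed

lemma vadd_eq_self_iff:
  assumes "0 < p" "x \<in> Fpn p n" "d \<in> Fpn p n"
  shows "vadd p x d = x \<longleftrightarrow> d = replicate n 0"
  using vadd_left_cancel[of x p n d "replicate n 0"] vadd_zero_right[of x p n] assms by auto

text \<open>2 is invertible modulo an odd number. This keeps x + 2d apart from x for nonzero d, so
  that the three points of a progression are distinct.\<close>

lemma vadd_double_eq_zero_iff:
  assumes "odd p" "d \<in> Fpn p n"
  shows "vadd p d d = replicate n 0 \<longleftrightarrow> d = replicate n 0"
proof
  assume h: "vadd p d d = replicate n 0"
  show "d = replicate n 0"
  proof (rule nth_equalityI)
    fix i assume "i < length d"
    hence i: "i < n" using assms by (simp add: Fpn_length)
    have "vadd p d d ! i = 0" using h i by simp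
    hence "(2 * d ! i) mod p = 0" using i assms by (simp add: Fpn_length mult_2)
    hence "p dvd 2 * d ! i" by auto
    hence "p dvd d ! i" using assms by (simp add: coprime_dvd_mult_right_iff)
    thus "d ! i = replicate n 0 ! i" using Fpn_nth[OF assms(2) i] i by (auto dest: dvd_imp_le)
  qed (use assms in \<open>simp add: Fpn_length\<close>)
next
  assume "d = replicate n 0"
  thus "vadd p d d = replicate n 0" using vadd_zero[OF assms(2)] by metis
qed

lemma vadd_append:
  "length x = length d \<Longrightarrow> vadd p (x @ y) (d @ e) = vadd p x d @ vadd p y e"
  by (simp add: vadd_def)

lemma append_in_Fpn: "x \<in> Fpn p n \<Longrightarrow> y \<in> Fpn p N \<Longrightarrow> x @ y \<in> Fpn p (n + N)"
  by (auto simp: Fpn_def)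

lemma Fpn_appendE:
  assumes "z \<in> Fpn p (n + N)"
  obtains x y where "z = x @ y" "x \<in> Fpn p n" "y \<in> Fpn p N"
proof
  show "z = take n z @ drop n z" by simp
  show "take n z \<in> Fpn p n" "drop n z \<in> Fpn p N"
    using assms by (auto simp: Fpn_def dest: in_set_takeD in_set_dropD)
qed

lemma aps_zero:
  assumes "0 < p" "A \<subseteq> Fpn p n"
  shows "aps p A (replicate n 0) = A"
proof -
  have "vadd p (replicate n 0) (replicate n 0) = replicate n 0"
    using vadd_zero[of "replicate n 0" p n] assms(1) by simp
  moreover have "vadd p x (replicate n 0) = x" if "x \<in> A" for x
    using vadd_zero_right[of x p n] assms(2) that by blast
  ultimately show ?thesis unfolding aps_def by auto
qed

subsection \<open>Matrices over the prime field\<close>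

text \<open>A matrix is the list of its columns.\<close>

fun mv :: "nat \<Rightarrow> nat \<Rightarrow> nat list list \<Rightarrow> nat list \<Rightarrow> nat list" where
  "mv p m (c # C) (a # y) = vadd p (vscale p a c) (mv p m C y)"
| "mv p m _ _ = replicate m 0"

definition mats :: "nat \<Rightarrow> nat \<Rightarrow> nat \<Rightarrow> nat list list set" where
  "mats p m N = {C. set C \<subseteq> Fpn p m \<and> length C = N}"

lemma finite_mats [simp]: "finite (mats p m N)"
  unfolding mats_def by (rule finite_lists_length_eq) simp

lemma card_mats: "card (mats p m N) = p ^ (m * N)"
  unfolding mats_def by (subst card_lists_length_eq) (simp_all add: power_mult)

lemma mats_0: "mats p m 0 = {[]}"
  by (auto simp: mats_def)

lemma mats_Suc: "mats p m (Suc N) = (\<lambda>(c, C). c # C) ` (Fpn p m \<times> mats p m N)"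
proof (intro equalityI subsetI)
  fix z assume "z \<in> mats p m (Suc N)"
  then show "z \<in> (\<lambda>(c, C). c # C) ` (Fpn p m \<times> mats p m N)"
    by (cases z) (auto simp: mats_def)
qed (auto simp: mats_def)

lemma mv_closed: "0 < p \<Longrightarrow> C \<in> mats p m N \<Longrightarrow> mv p m C y \<in> Fpn p m"
proof (induction C arbitrary: N y)
  case (Cons c C)
  then show ?case by (cases y) (auto simp: mats_def)
qed simp

lemma vscale_add: "vscale p ((a + b) mod p) c = vadd p (vscale p a c) (vscale p b c)"
  by (rule nth_equalityI) (auto simp: mod_simps distrib_right)

lemma mv_add:
  assumes "0 < p" "C \<in> mats p m N" "y \<in> Fpn p N" "z \<in> Fpn p N"
  shows "mv p m C (vadd p y z) = vadd p (mv p m C y) (mv p m C z)"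
  using assms
proof (induction N arbitrary: C y z)
  case 0
  then show ?case
    using vadd_zero[of "replicate m 0" p m] by (simp add: mats_0 vadd_def)
next
  case (Suc N)
  then obtain c C' where C: "C = c # C'" "c \<in> Fpn p m" "C' \<in> mats p m N"
    by (auto simp: mats_Suc)
  obtain a y' where y: "y = a # y'" "y' \<in> Fpn p N" using Suc.prems by (auto simp: Fpn_Suc)
  obtain b z' where z: "z = b # z'" "z' \<in> Fpn p N" using Suc.prems by (auto simp: Fpn_Suc)
  have e: "vadd p (a # y') (b # z') = ((a + b) mod p) # vadd p y' z'" by (simp add: vadd_def)
  show ?case
    unfolding C y(1) z(1) e using Suc.IH[OF Suc.prems(1) C(3) y(2) z(2)]
    by (simp add: vscale_add vadd_ac)
qed

lemma mv_zero:
  assumes "0 < p" "C \<in> mats p m N"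
  shows "mv p m C (replicate N 0) = replicate m 0"
proof -
  have z: "replicate N 0 \<in> Fpn p N" using assms(1) by simp
  have "vadd p (mv p m C (replicate N 0)) (mv p m C (replicate N 0)) = mv p m C (replicate N 0)"
    using mv_add[OF assms z z] vadd_zero[OF z] by metis
  thus ?thesis using vadd_eq_self_iff[OF assms(1) mv_closed mv_closed] assms by blast
qed

text \<open>Since \<open>p\<close> is prime and \<open>a\<close> is a nonzero residue, the map c ->
  a c + u is injective, hence a permutation of the finite set \<open>Fpn p m\<close>.\<close>

lemma card_vscale_solutions:
  assumes p: "prime p" and a: "a < p" "a \<noteq> 0" and u: "u \<in> Fpn p m" and b: "b \<in> Fpn p m"
  shows "card {c \<in> Fpn p m. vadd p (vscale p a c) u = b} = 1"
proof -
  have p0: "0 < p" using p prime_gt_0_nat by blast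
  let ?f = "\<lambda>c. vadd p (vscale p a c) u"
  have inj: "inj_on ?f (Fpn p m)"
  proof (rule inj_onI)
    fix x y assume xy: "x \<in> Fpn p m" "y \<in> Fpn p m" "?f x = ?f y"
    have s: "vscale p a x = vscale p a y"
    proof (rule vadd_left_cancel[OF u])
      show "vadd p u (vscale p a x) = vadd p u (vscale p a y)"
        using xy(3) vadd_commute by metis
    qed (use xy p0 in simp_all)
    show "x = y"
    proof (rule nth_equalityI)
      fix i assume "i < length x"
      hence i: "i < m" using xy by (simp add: Fpn_length)
      have "(a * x ! i) mod p = (a * y ! i) mod p"
        using arg_cong[OF s, of "\<lambda>w. w ! i"] i xy by (simp add: Fpn_length)
      hence "int ((a * x ! i) mod p) = int ((a * y ! i) mod p)" by (rule arg_cong)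
      hence "int p dvd int a * int (x ! i) - int a * int (y ! i)"
        by (simp add: zmod_int mod_eq_dvd_iff)
      hence "int p dvd int a * (int (x ! i) - int (y ! i))" by (simp add: right_diff_distrib)
      moreover have "\<not> int p dvd int a" using a by (auto dest: dvd_imp_le)
      moreover have "prime (int p)" using p by simp
      ultimately have "int p dvd int (x ! i) - int (y ! i)" using prime_dvd_mult_iff by blast
      hence "int (x ! i) mod int p = int (y ! i) mod int p" by (simp add: mod_eq_dvd_iff)
      thus "x ! i = y ! i" using Fpn_nth[OF xy(1) i] Fpn_nth[OF xy(2) i] by simp
    qed (use xy in \<open>simp add: Fpn_length\<close>)
  qed
  have "?f ` Fpn p m = Fpn p m"
    by (rule endo_inj_surj) (use inj u p0 in auto)
  hence "b \<in> ?f ` Fpn p m" using b by simp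
  then obtain c where c: "c \<in> Fpn p m" "?f c = b" by (auto simp only: image_iff)
  have "{c \<in> Fpn p m. ?f c = b} = {c}"
  proof (intro equalityI subsetI)
    fix c' assume "c' \<in> {c \<in> Fpn p m. ?f c = b}"
    thus "c' \<in> {c}" using inj_onD[OF inj, of c' c] c by simp
  qed (use c in blast)
  thus ?thesis by simp
qed

text \<open>A uniformly random matrix sends a fixed nonzero \<open>y\<close> to a uniformly
  distributed vector. If the leading coordinate of \<open>y\<close> is nonzero, the first column is
  determined by the others; if it is zero, that column is free and induction applies. The factor
  \<open>p ^ m\<close> stands on the left to avoid truncated subtraction of exponents.\<close>

lemma card_mv_solutions:
  assumes p: "prime p" and "y \<in> Fpn p N" "y \<noteq> replicate N 0" "b \<in> Fpn p m"
  shows "card {C \<in> mats p m N. mv p m C y = b} * p ^ m = p ^ (m * N)"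
  using assms(2-)
proof (induction N arbitrary: y b)
  case 0
  then show ?case by simp
next
  case (Suc N)
  have p0: "0 < p" using p prime_gt_0_nat by blast
  obtain a y' where y: "y = a # y'" "y' \<in> Fpn p N" "a < p" using Suc.prems by (auto simp: Fpn_Suc)
  let ?S = "{C \<in> mats p m (Suc N). mv p m C y = b}"
  show ?case
  proof (cases "a = 0")
    case False
    have "?S = (\<lambda>(C, c). c # C) ` (SIGMA C:mats p m N. {c \<in> Fpn p m. vadd p (vscale p a c) (mv p m C y') = b})"
      by (auto simp: mats_Suc y image_iff)
    hence "card ?S = card (SIGMA C:mats p m N. {c \<in> Fpn p m. vadd p (vscale p a c) (mv p m C y') = b})"
      by (simp add: card_image inj_on_def)
    also have "\<dots> = (\<Sum>C\<in>mats p m N. 1)"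
      by (subst card_SigmaI)
        (auto simp del: One_nat_def sum_constant intro!: sum.cong card_vscale_solutions p y False Suc.prems mv_closed[OF p0])
    also have "\<dots> = p ^ (m * N)" by (simp add: card_mats)
    finally show ?thesis by (simp add: power_add mult.commute)
  next
    case True
    have y': "y' \<noteq> replicate N 0" using Suc.prems y True by auto
    have v0: "vscale p 0 c = replicate m 0" if "c \<in> Fpn p m" for c
      using that by (auto intro!: nth_equalityI simp: Fpn_length)
    have e: "mv p m (c # C) y = mv p m C y'" if "c \<in> Fpn p m" "C \<in> mats p m N" for c C
      using that mv_closed[OF p0] by (simp add: y True v0 vadd_zero)
    have "?S = (\<lambda>(c, C). c # C) ` (Fpn p m \<times> {C \<in> mats p m N. mv p m C y' = b})"
      by (auto simp: mats_Suc e image_iff)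
    hence "card ?S = p ^ m * card {C \<in> mats p m N. mv p m C y' = b}"
      by (simp add: card_image inj_on_def card_cartesian_product)
    thus ?thesis using Suc.IH[OF y(2) y' Suc.prems(3)] by (simp add: power_add mult.assoc)
  qed
qed

subsection \<open>Random families of matrices\<close>

definition ker :: "nat \<Rightarrow> nat \<Rightarrow> nat \<Rightarrow> ('a \<Rightarrow> nat list list) \<Rightarrow> 'a set \<Rightarrow> nat list set" where
  "ker p m N v S = {y \<in> Fpn p N. \<forall>x\<in>S. mv p m (v x) y = replicate m 0}"

lemma finite_ker [simp]: "finite (ker p m N v S)"
  by (simp add: ker_def)

text \<open>Subtracting a fixed element of \<open>F\<close> maps \<open>F\<close> injectively into
  the joint kernel. \<open>F\<close> may be any set on which the maps are constant, so that fibres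
  prescribed at shifted arguments are covered as well.\<close>

lemma card_fibre_le_ker:
  assumes p: "0 < p" and v: "\<And>x. x \<in> S \<Longrightarrow> v x \<in> mats p m N" and F: "F \<subseteq> Fpn p N"
    and eq: "\<And>x y z. x \<in> S \<Longrightarrow> y \<in> F \<Longrightarrow> z \<in> F \<Longrightarrow> mv p m (v x) y = mv p m (v x) z"
  shows "card F \<le> card (ker p m N v S)"
proof (cases "F = {}")
  case False
  then obtain y0 where y0: "y0 \<in> F" by blast
  have y0': "y0 \<in> Fpn p N" using y0 F by blast
  have "inj_on (\<lambda>y. vadd p (vneg p y0) y) F"
    using vadd_left_cancel[of "vneg p y0" p N] y0' F p by (auto intro!: inj_onI)
  moreover have "(\<lambda>y. vadd p (vneg p y0) y) ` F \<subseteq> ker p m N v S"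
  proof safe
    fix y assume y: "y \<in> F"
    have "mv p m (v x) (vadd p (vneg p y0) y) = replicate m 0" if x: "x \<in> S" for x
    proof -
      have "mv p m (v x) (vadd p (vneg p y0) y)
          = vadd p (mv p m (v x) (vneg p y0)) (mv p m (v x) y)"
        using y y0' F p by (intro mv_add[OF p v[OF x]]) auto
      also have "\<dots> = vadd p (mv p m (v x) (vneg p y0)) (mv p m (v x) y0)"
        using eq[OF x y y0] by simp
      also have "\<dots> = mv p m (v x) (vadd p (vneg p y0) y0)"
        using y0' p by (intro mv_add[OF p v[OF x], symmetric]) auto
      also have "\<dots> = replicate m 0"
        using vadd_vneg[OF y0'] mv_zero[OF p v[OF x]] vadd_commute by metis
      finally show ?thesis .
    qed
    thus "vadd p (vneg p y0) y \<in> ker p m N v S"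
      using y y0' F p by (auto simp: ker_def)
  qed
  ultimately show ?thesis by (metis card_inj_on_le finite_ker)
qed simp

text \<open>Counting form of rank-nullity: every nonempty fibre of the joint map is a translate of
  its kernel.\<close>

lemma card_ker_mult_card_image:
  assumes p: "0 < p" and v: "\<And>x. x \<in> S \<Longrightarrow> v x \<in> mats p m N"
  shows "card (ker p m N v S) * card ((\<lambda>y. restrict (\<lambda>x. mv p m (v x) y) S) ` Fpn p N) = p ^ N"
proof -
  let ?f = "\<lambda>y. restrict (\<lambda>x. mv p m (v x) y) S"
  have fib: "card {y \<in> Fpn p N. ?f y = b} = card (ker p m N v S)" if "b \<in> ?f ` Fpn p N" for b
  proof (rule antisym)
    obtain y0 where y0: "y0 \<in> Fpn p N" "b = ?f y0" using \<open>b \<in> _\<close> by blast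
    show "card {y \<in> Fpn p N. ?f y = b} \<le> card (ker p m N v S)"
    proof (rule card_fibre_le_ker[OF p v])
      fix x y z assume "x \<in> S" "y \<in> {y \<in> Fpn p N. ?f y = b}" "z \<in> {y \<in> Fpn p N. ?f y = b}"
      hence "?f y x = ?f z x" by simp
      thus "mv p m (v x) y = mv p m (v x) z" using \<open>x \<in> S\<close> by simp
    qed auto
    have "inj_on (vadd p y0) (ker p m N v S)"
      using vadd_left_cancel[OF y0(1)] by (auto intro!: inj_onI simp: ker_def)
    moreover have "vadd p y0 ` ker p m N v S \<subseteq> {y \<in> Fpn p N. ?f y = b}"
    proof safe
      fix y assume y: "y \<in> ker p m N v S"
      hence yF: "y \<in> Fpn p N" by (simp add: ker_def)
      show "vadd p y0 y \<in> Fpn p N" using y0 yF p by simp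
      have "mv p m (v x) (vadd p y0 y) = mv p m (v x) y0" if x: "x \<in> S" for x
        using mv_add[OF p v[OF x] y0(1) yF] y x vadd_zero_right[OF mv_closed[OF p v[OF x]]]
        by (simp add: ker_def)
      thus "?f (vadd p y0 y) = b" unfolding y0(2) by (intro restrict_ext) simp
    qed
    ultimately show "card (ker p m N v S) \<le> card {y \<in> Fpn p N. ?f y = b}"
      by (intro card_inj_on_le[of "vadd p y0"]) simp_all
  qed
  have "p ^ N = (\<Sum>y\<in>Fpn p N. 1)" by simp
  also have "\<dots> = (\<Sum>b\<in>?f ` Fpn p N. \<Sum>y | y \<in> Fpn p N \<and> ?f y = b. 1)"
    by (rule sum.image_gen) simp
  also have "\<dots> = (\<Sum>b\<in>?f ` Fpn p N. card (ker p m N v S))"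
    by (intro sum.cong refl) (use fib in simp)
  finally show ?thesis by simp
qed

text \<open>The kernel is at least as large as in the jointly surjective case, and its size is a power of
  \<open>p\<close>; so it either has exactly that size or is larger by a factor of two.\<close>

lemma card_ker_dichotomy:
  assumes p: "prime p" and v: "\<And>x. x \<in> S \<Longrightarrow> v x \<in> mats p m N" and S: "finite S"
  shows "card (ker p m N v S) * p ^ (m * card S) = p ^ N \<or>
         2 * p ^ N \<le> card (ker p m N v S) * p ^ (m * card S)"
proof -
  have p0: "0 < p" "1 < p" using p prime_gt_0_nat prime_gt_1_nat by blast+
  let ?I = "(\<lambda>y. restrict (\<lambda>x. mv p m (v x) y) S) ` Fpn p N"
  note eq = card_ker_mult_card_image[of p S v m N, OF p0(1) v]
  have sub: "?I \<subseteq> PiE S (\<lambda>_. Fpn p m)"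
    using mv_closed[OF p0(1) v] by auto
  have "card ?I \<le> card (PiE S (\<lambda>_. Fpn p m))"
    by (rule card_mono[OF _ sub]) (simp add: finite_PiE S)
  hence le: "card ?I \<le> p ^ (m * card S)" using S by (simp add: card_PiE power_mult)
  \<comment> \<open>A divisor of \<open>p ^ N\<close> is again a power of \<open>p\<close>, so the
    image falls short of its maximal size by an integral power of \<open>p\<close>.\<close>
  have "card ?I dvd p ^ N" using eq by (metis dvd_triv_right)
  then obtain i where i: "card ?I = p ^ i" using divides_primepow_nat[OF p] by blast
  hence im: "i \<le> m * card S" using le p0(2) by (metis power_le_imp_le_exp)
  have "p ^ (m * card S) = p ^ i * p ^ (m * card S - i)" using im by (simp flip: power_add)
  hence *: "card (ker p m N v S) * p ^ (m * card S) = p ^ N * p ^ (m * card S - i)"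
    using eq i by (simp flip: mult.assoc)
  show ?thesis
  proof (cases "m * card S - i")
    case (Suc j)
    have "2 * 1 \<le> p * p ^ j" using p0 by (intro mult_le_mono) auto
    hence "p ^ N * 2 \<le> p ^ N * p ^ (m * card S - i)" unfolding Suc by simp
    thus ?thesis using * by simp
  qed (use * in simp)
qed

lemma sum_mats_weighted:
  assumes p: "prime p" and y: "y \<in> Fpn p N"
  shows "(\<Sum>C\<in>mats p m N. of_bool (mv p m C y = replicate m 0) :: real)
     = real p ^ (m * N) * (if y = replicate N 0 then 1 else 1 / real p ^ m)"
proof -
  have p0: "0 < p" using p prime_gt_0_nat by blast
  have "(\<Sum>C\<in>mats p m N. of_bool (mv p m C y = replicate m 0) :: real)
     = real (card {C \<in> mats p m N. mv p m C y = replicate m 0})"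
    by (simp add: sum_of_bool_eq Int_def)
  also have "\<dots> = real p ^ (m * N) * (if y = replicate N 0 then 1 else 1 / real p ^ m)"
  proof (cases "y = replicate N 0")
    case True
    hence "{C \<in> mats p m N. mv p m C y = replicate m 0} = mats p m N"
      using mv_zero[OF p0] by auto
    thus ?thesis using True by (simp add: card_mats)
  next
    case False
    have "real (card {C \<in> mats p m N. mv p m C y = replicate m 0}) * real p ^ m = real p ^ (m * N)"
      using card_mv_solutions[OF p y False zero_in_Fpn[OF p0], of m]
      unfolding of_nat_mult[symmetric] of_nat_power[symmetric] by (rule arg_cong)
    thus ?thesis using False p0 by (simp add: field_simps)
  qed
  finally show ?thesis .
qed

text \<open>Linearity of expectation over y: the matrices are independent, so a nonzero y lies in
  the kernel with probability p^(-m |S|), while the zero vector always does.\<close>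

lemma sum_card_ker:
  assumes p: "prime p" and A: "finite A" and S: "S \<subseteq> A"
  shows "(\<Sum>v\<in>PiE A (\<lambda>_. mats p m N). real (card (ker p m N v S)))
     = (real p ^ (m * N)) ^ card A * (1 + (real p ^ N - 1) / real p ^ (m * card S))"
proof -
  have p0: "0 < p" using p prime_gt_0_nat by blast
  let ?T = "real p ^ (m * N)"
  \<comment> \<open>The value 1 outside \<open>S\<close> turns the product over \<open>S\<close>
    into one over all of \<open>A\<close>, as needed to exchange product and sum over
    \<open>PiE A\<close>.\<close>
  let ?g = "\<lambda>y x C. if x \<in> S then of_bool (mv p m C y = replicate m 0) else 1 :: real"
  let ?q = "\<lambda>y. if y = replicate N 0 then 1 else 1 / real p ^ m"
  have fS: "finite S" using A S finite_subset by blast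
  have "(\<Sum>v\<in>PiE A (\<lambda>_. mats p m N). real (card (ker p m N v S)))
      = (\<Sum>v\<in>PiE A (\<lambda>_. mats p m N). \<Sum>y\<in>Fpn p N. \<Prod>x\<in>A. ?g y x (v x))"
  proof (intro sum.cong refl)
    fix v
    have "(\<Prod>x\<in>A. ?g y x (v x)) = of_bool (\<forall>x\<in>S. mv p m (v x) y = replicate m 0)" for y
    proof -
      have "(\<Prod>x\<in>A. ?g y x (v x)) = (\<Prod>x\<in>S. of_bool (mv p m (v x) y = replicate m 0))"
        using S A by (simp add: prod.If_cases Int_absorb1)
      also have "\<dots> = of_bool (\<forall>x\<in>S. mv p m (v x) y = replicate m 0)"
        using fS by (induction S rule: finite_induct) auto
      finally show ?thesis .
    qed
    thus "real (card (ker p m N v S)) = (\<Sum>y\<in>Fpn p N. \<Prod>x\<in>A. ?g y x (v x))"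
      by (simp add: sum_of_bool_eq ker_def Int_def)
  qed
  also have "\<dots> = (\<Sum>y\<in>Fpn p N. \<Prod>x\<in>A. \<Sum>C\<in>mats p m N. ?g y x C)"
    by (subst sum.swap) (intro sum.cong refl prod_sum_PiE[symmetric] A finite_mats)
  also have "\<dots> = (\<Sum>y\<in>Fpn p N. ?T ^ card A * ?q y ^ card S)"
  proof (intro sum.cong refl)
    fix y assume y: "y \<in> Fpn p N"
    have "(\<Prod>x\<in>A. \<Sum>C\<in>mats p m N. ?g y x C) = (\<Prod>x\<in>A. ?T * (if x \<in> S then ?q y else 1))"
      using sum_mats_weighted[OF p y, of m] by (intro prod.cong refl) (simp add: card_mats)
    also have "\<dots> = ?T ^ card A * (\<Prod>x\<in>A. if x \<in> S then ?q y else 1)"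
      by (simp add: prod.distrib)
    also have "(\<Prod>x\<in>A. if x \<in> S then ?q y else 1) = ?q y ^ card S"
      using S A by (simp add: prod.If_cases Int_absorb1)
    finally show "(\<Prod>x\<in>A. \<Sum>C\<in>mats p m N. ?g y x C) = ?T ^ card A * ?q y ^ card S" .
  qed
  also have "\<dots> = ?T ^ card A * (\<Sum>y\<in>Fpn p N. ?q y ^ card S)"
    by (simp only: sum_distrib_left)
  also have "(\<Sum>y\<in>Fpn p N. ?q y ^ card S)
      = 1 + (\<Sum>y\<in>Fpn p N - {replicate N 0}. (1 / real p ^ m) ^ card S)"
    using p0 by (subst sum.remove[of _ "replicate N 0"]) (auto intro!: sum.cong)
  also have "\<dots> = 1 + (real p ^ N - 1) / real p ^ (m * card S)"
    using p0 by (simp add: card_Diff_singleton of_nat_diff power_divide power_mult)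
  finally show ?thesis .
qed

text \<open>Exponential moment for a Chernoff bound: the power of 2 is a product over
  \<open>A\<close> of independent factors, 2 at a zero and 1 elsewhere, each of mean 1 +
  p^-m.\<close>

lemma sum_power_zeros:
  assumes p: "prime p" and A: "finite A" and y: "y \<in> Fpn p N" "y \<noteq> replicate N 0"
  shows "(\<Sum>v\<in>PiE A (\<lambda>_. mats p m N). 2 ^ card {x \<in> A. mv p m (v x) y = replicate m 0} :: real)
     = (real p ^ (m * N)) ^ card A * (1 + 1 / real p ^ m) ^ card A"
proof -
  let ?g = "\<lambda>C. 1 + of_bool (mv p m C y = replicate m 0) :: real"
  have "(\<Sum>v\<in>PiE A (\<lambda>_. mats p m N). 2 ^ card {x \<in> A. mv p m (v x) y = replicate m 0} :: real)
      = (\<Sum>v\<in>PiE A (\<lambda>_. mats p m N). \<Prod>x\<in>A. ?g (v x))"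
  proof (intro sum.cong refl)
    fix v
    have "(\<Prod>x\<in>A. ?g (v x)) = (\<Prod>x\<in>A. if mv p m (v x) y = replicate m 0 then 2 else 1)"
      by (intro prod.cong) auto
    also have "\<dots> = 2 ^ card {x \<in> A. mv p m (v x) y = replicate m 0}"
      using A by (simp add: prod.If_cases Int_def)
    finally show "2 ^ card {x \<in> A. mv p m (v x) y = replicate m 0} = (\<Prod>x\<in>A. ?g (v x))" by simp
  qed
  also have "\<dots> = (\<Prod>x\<in>A. \<Sum>C\<in>mats p m N. ?g C)"
    by (intro prod_sum_PiE[symmetric] A finite_mats)
  also have "\<dots> = (real p ^ (m * N) * (1 + 1 / real p ^ m)) ^ card A"
    unfolding sum.distrib sum_mats_weighted[OF p y(1)] using y(2)
    by (simp add: card_mats distrib_left)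
  finally show ?thesis by (simp add: power_mult_distrib)
qed

text \<open>First moment method. For random \<open>v\<close> the excess of each kernel size over its generic value
  and the exponential moment \<open>2 ^ Z\<close> of the number \<open>Z\<close> of zeros of each \<open>y\<close> are
  collected in one sum; every violated condition contributes at least \<open>1\<close> to it.\<close>

lemma exists_good_matrices:
  fixes t :: real
  assumes p: "prime p" and A: "finite A" and FF: "finite \<F>" "\<And>S. S \<in> \<F> \<Longrightarrow> S \<subseteq> A"
    and small: "(\<Sum>S\<in>\<F>. real p ^ (m * card S)) / real p ^ N
       + real p ^ N * (1 + 1 / real p ^ m) ^ card A * 2 powr (- t) < 1"
  shows "\<exists>v\<in>PiE A (\<lambda>_. mats p m N).
       (\<forall>S\<in>\<F>. card (ker p m N v S) * p ^ (m * card S) = p ^ N) \<and>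
       (\<forall>y\<in>Fpn p N. y \<noteq> replicate N 0 \<longrightarrow>
          real (card {x \<in> A. mv p m (v x) y = replicate m 0}) < t)"
proof (rule ccontr)
  assume none: "\<not> ?thesis"
  have p0: "0 < p" using p prime_gt_0_nat by blast
  let ?\<Omega> = "PiE A (\<lambda>_. mats p m N)"
  let ?T = "(real p ^ (m * N)) ^ card A"
  let ?Y = "Fpn p N - {replicate N 0}"
  let ?a = "\<lambda>v S. real (card (ker p m N v S)) * real p ^ (m * card S) / real p ^ N - 1"
  let ?b = "\<lambda>v y. 2 ^ card {x \<in> A. mv p m (v x) y = replicate m 0} * 2 powr (- t)"
  have T: "real (card ?\<Omega>) = ?T" using A by (simp add: card_PiE card_mats)
  have T0: "0 < ?T" using p0 by simp
  \<comment> \<open>The dichotomy for kernel sizes leaves no excess strictly between 0 and 1, so a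
    violated kernel condition costs at least 1.\<close>
  have dich: "?a v S = 0 \<or> 1 \<le> ?a v S"
    and dich_eq: "?a v S = 0 \<longrightarrow> card (ker p m N v S) * p ^ (m * card S) = p ^ N"
    if v: "v \<in> ?\<Omega>" and S: "S \<in> \<F>" for v S
  proof -
    let ?K = "card (ker p m N v S) * p ^ (m * card S)"
    have SA: "S \<subseteq> A" using FF(2) S by blast
    have eq: "?a v S = real ?K / real (p ^ N) - 1" by simp
    have "finite S" using SA A finite_subset by blast
    hence d: "?K = p ^ N \<or> 2 * p ^ N \<le> ?K"
      using card_ker_dichotomy[OF p, of S v m N] v SA by (auto simp: PiE_iff)
    have pos: "0 < real (p ^ N)" using p0 by simp
    have h1: "2 * p ^ N \<le> ?K \<Longrightarrow> 1 \<le> ?a v S"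
    proof -
      assume "2 * p ^ N \<le> ?K"
      hence "real (2 * p ^ N) \<le> real ?K" by (simp only: of_nat_le_iff)
      hence "2 \<le> real ?K / real (p ^ N)" using pos by (simp add: pos_le_divide_eq)
      thus "1 \<le> ?a v S" unfolding eq by simp
    qed
    have h2: "?K = p ^ N \<Longrightarrow> ?a v S = 0" unfolding eq using pos by simp
    show "?a v S = 0 \<or> 1 \<le> ?a v S" using d h1 h2 by blast
    show "?a v S = 0 \<longrightarrow> ?K = p ^ N" using d h1 by (metis not_one_le_zero)
  qed
  have ge1: "1 \<le> (\<Sum>S\<in>\<F>. ?a v S) + (\<Sum>y\<in>?Y. ?b v y)" if v: "v \<in> ?\<Omega>" for v
  proof -
    have a0: "0 \<le> ?a v S" if "S \<in> \<F>" for S using dich[OF v that] by linarith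
    have sa: "0 \<le> (\<Sum>S\<in>\<F>. ?a v S)" by (rule sum_nonneg) (use a0 in auto)
    have sb: "0 \<le> (\<Sum>y\<in>?Y. ?b v y)" by (rule sum_nonneg) simp
    from none v consider S where "S \<in> \<F>" "card (ker p m N v S) * p ^ (m * card S) \<noteq> p ^ N"
      | y where "y \<in> ?Y" "t \<le> real (card {x \<in> A. mv p m (v x) y = replicate m 0})"
      by (auto simp: not_less)
    then show ?thesis
    proof cases
      case 1
      hence "1 \<le> ?a v S" using dich[OF v] dich_eq[OF v] by blast
      also have "?a v S \<le> (\<Sum>S\<in>\<F>. ?a v S)"
        by (rule member_le_sum) (use 1 FF a0 in auto)
      finally show ?thesis using sb by linarith
    next
      case 2
      have "1 = 2 powr t * 2 powr (- t)" by (simp flip: powr_add)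
      also have "\<dots> \<le> 2 powr real (card {x \<in> A. mv p m (v x) y = replicate m 0}) * 2 powr (- t)"
        using 2 by (intro mult_right_mono powr_mono) auto
      also have "\<dots> = ?b v y" by (simp add: powr_realpow)
      also have "?b v y \<le> (\<Sum>y\<in>?Y. ?b v y)"
        by (rule member_le_sum) (use 2 in auto)
      finally show ?thesis using sa by linarith
    qed
  qed
  have "?T = (\<Sum>v\<in>?\<Omega>. 1)" using T by simp
  also have "\<dots> \<le> (\<Sum>v\<in>?\<Omega>. (\<Sum>S\<in>\<F>. ?a v S) + (\<Sum>y\<in>?Y. ?b v y))"
    by (rule sum_mono) (rule ge1)
  also have "\<dots> = (\<Sum>S\<in>\<F>. \<Sum>v\<in>?\<Omega>. ?a v S) + (\<Sum>y\<in>?Y. \<Sum>v\<in>?\<Omega>. ?b v y)"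
    by (simp only: sum.distrib sum.swap[of _ _ ?\<Omega>])
  also have "(\<Sum>S\<in>\<F>. \<Sum>v\<in>?\<Omega>. ?a v S) \<le> (\<Sum>S\<in>\<F>. ?T * (real p ^ (m * card S) / real p ^ N))"
  proof (rule sum_mono)
    fix S assume S: "S \<in> \<F>"
    have "(\<Sum>v\<in>?\<Omega>. ?a v S)
        = (\<Sum>v\<in>?\<Omega>. real (card (ker p m N v S))) * (real p ^ (m * card S) / real p ^ N) - ?T"
      unfolding T[symmetric] by (simp add: sum_subtractf sum_distrib_right sum_divide_distrib)
    also have "\<dots> = ?T * ((real p ^ (m * card S) - 1) / real p ^ N)"
      unfolding sum_card_ker[OF p A FF(2)[OF S]] using p0 by (simp add: field_simps)
    also have "\<dots> \<le> ?T * (real p ^ (m * card S) / real p ^ N)"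
      using p0 by (intro mult_left_mono divide_right_mono) auto
    finally show "(\<Sum>v\<in>?\<Omega>. ?a v S) \<le> ?T * (real p ^ (m * card S) / real p ^ N)" .
  qed
  also have "(\<Sum>y\<in>?Y. \<Sum>v\<in>?\<Omega>. ?b v y)
      = (\<Sum>y\<in>?Y. ?T * ((1 + 1 / real p ^ m) ^ card A * 2 powr (- t)))"
  proof (intro sum.cong refl)
    fix y assume "y \<in> ?Y"
    thus "(\<Sum>v\<in>?\<Omega>. ?b v y) = ?T * ((1 + 1 / real p ^ m) ^ card A * 2 powr (- t))"
      using sum_power_zeros[OF p A, of y N m] by (simp flip: sum_distrib_right)
  qed
  also have "\<dots> \<le> ?T * (real p ^ N * (1 + 1 / real p ^ m) ^ card A * 2 powr (- t))"
  proof -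
    have "real (card ?Y) \<le> real p ^ N"
      using p0 by (simp add: card_Diff_singleton)
    hence "real (card ?Y) * ((1 + 1 / real p ^ m) ^ card A * 2 powr (- t))
        \<le> real p ^ N * ((1 + 1 / real p ^ m) ^ card A * 2 powr (- t))"
      by (intro mult_right_mono) auto
    thus ?thesis using T0 by (simp add: mult.assoc mult.left_commute)
  qed
  also have "(\<Sum>S\<in>\<F>. ?T * (real p ^ (m * card S) / real p ^ N))
      = ?T * ((\<Sum>S\<in>\<F>. real p ^ (m * card S)) / real p ^ N)"
    by (simp add: sum_distrib_left sum_divide_distrib)
  finally have "?T * 1 \<le> ?T * ((\<Sum>S\<in>\<F>. real p ^ (m * card S)) / real p ^ N
       + real p ^ N * (1 + 1 / real p ^ m) ^ card A * 2 powr (- t))"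
    by (simp add: distrib_left)
  thus False using small T0 by (simp add: mult_le_cancel_left_pos)
qed

subsection \<open>Sets with few progressions\<close>

text \<open>A popular sphere among the vectors with digits at most \<open>q\<close>. No carries occur modulo
  \<open>2 * q + 1\<close> when \<open>x + z = 2 y\<close> is read digit by digit, so strict convexity of the norm applies.\<close>

lemma exists_cap:
  assumes p: "p = 2 * q + 1"
  shows "\<exists>B \<subseteq> Fpn p m. (\<forall>d\<in>Fpn p m. d \<noteq> replicate m 0 \<longrightarrow> aps p B d = {}) \<and>
     (q + 1) ^ m \<le> card B * (m * q\<^sup>2 + 1)"
proof -
  define E where "E = {x. set x \<subseteq> {..q} \<and> length x = m}"
  define nrm where "nrm = (\<lambda>x::nat list. \<Sum>i<m. (x ! i)\<^sup>2)"
  have fE: "finite E" unfolding E_def by (rule finite_lists_length_eq) simp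
  have cE: "card E = (q + 1) ^ m" unfolding E_def by (subst card_lists_length_eq) simp_all
  have E_nth: "x ! i \<le> q" if "x \<in> E" "i < m" for x i
    using that nth_mem[of i x] by (auto simp: E_def simp del: nth_mem)
  have E_Fpn: "E \<subseteq> Fpn p m" using p by (auto simp: E_def Fpn_def)
  have nrm_le: "nrm x \<le> m * q\<^sup>2" if "x \<in> E" for x
  proof -
    have "nrm x \<le> (\<Sum>i<m. q\<^sup>2)"
      unfolding nrm_def using E_nth[OF that] by (intro sum_mono power_mono) auto
    thus ?thesis by simp
  qed
  \<comment> \<open>Pigeonhole: the squared norm takes at most m q^2 + 1 values on
    \<open>E\<close>.\<close>
  have "\<exists>r\<in>{..m * q\<^sup>2}. (q + 1) ^ m \<le> card {x \<in> E. nrm x = r} * (m * q\<^sup>2 + 1)"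
  proof (rule ccontr)
    assume "\<not> ?thesis"
    hence lt: "card {x \<in> E. nrm x = r} * (m * q\<^sup>2 + 1) < (q + 1) ^ m" if "r \<le> m * q\<^sup>2" for r
      using that by (auto simp: not_le)
    have "card E = (\<Sum>x\<in>E. 1)" by simp
    also have "\<dots> = (\<Sum>r\<le>m * q\<^sup>2. \<Sum>x | x \<in> E \<and> nrm x = r. 1)"
      by (rule sum.group[symmetric]) (use fE nrm_le in auto)
    finally have "card E = (\<Sum>r\<le>m * q\<^sup>2. card {x \<in> E. nrm x = r})" by simp
    hence "card E * (m * q\<^sup>2 + 1) = (\<Sum>r\<le>m * q\<^sup>2. card {x \<in> E. nrm x = r} * (m * q\<^sup>2 + 1))"
      by (simp only: sum_distrib_right)
    also have "\<dots> < (\<Sum>r\<le>m * q\<^sup>2. (q + 1) ^ m)"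
      by (rule sum_strict_mono) (use lt in auto)
    finally show False by (simp add: cE mult.commute)
  qed
  then obtain r where r: "(q + 1) ^ m \<le> card {x \<in> E. nrm x = r} * (m * q\<^sup>2 + 1)" by blast
  let ?B = "{x \<in> E. nrm x = r}"
  have "aps p ?B d = {}" if d: "d \<in> Fpn p m" "d \<noteq> replicate m 0" for d
  proof (rule ccontr)
    assume "aps p ?B d \<noteq> {}"
    then obtain x where x: "x \<in> ?B" "vadd p x d \<in> ?B" "vadd p x (vadd p d d) \<in> ?B"
      unfolding aps_def by auto
    define y z where "y = vadd p x d" and "z = vadd p x (vadd p d d)"
    have E: "x \<in> E" "y \<in> E" "z \<in> E" and n: "nrm x = r" "nrm y = r" "nrm z = r"
      using x by (auto simp: y_def z_def)
    have len: "length x = m" "length d = m" using E d by (auto simp: E_def Fpn_length)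
    have mid: "x ! i + z ! i = 2 * y ! i" if i: "i < m" for i
    proof -
      have "(x ! i + z ! i) mod p = (2 * y ! i) mod p"
        using i len by (simp add: y_def z_def mod_add_right_eq mod_mult_right_eq algebra_simps flip: mult_2)
      thus ?thesis using E_nth[OF E(1) i] E_nth[OF E(2) i] E_nth[OF E(3) i] p by simp
    qed
    \<comment> \<open>Parallelogram identity with x + z = 2y. Summed over the coordinates it gives
      |x - z|^2 = 2r + 2r - 4r = 0. The integers avoid truncated differences.\<close>
    have sq: "(int (x ! i) - int (z ! i))\<^sup>2 = 2 * (int (x ! i))\<^sup>2 + 2 * (int (z ! i))\<^sup>2 - 4 * (int (y ! i))\<^sup>2"
      if i: "i < m" for i
    proof -
      have "int (x ! i) + int (z ! i) = 2 * int (y ! i)" using mid[OF i] by linarith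
      hence "(int (x ! i) + int (z ! i))\<^sup>2 = 4 * (int (y ! i))\<^sup>2" by (simp add: power_mult_distrib)
      thus ?thesis by (simp add: power2_eq_square algebra_simps)
    qed
    have "(\<Sum>i<m. (int (x ! i) - int (z ! i))\<^sup>2) = 2 * int (nrm x) + 2 * int (nrm z) - 4 * int (nrm y)"
      by (simp add: sq nrm_def sum_subtractf sum.distrib sum_distrib_left)
    hence "(\<Sum>i<m. (int (x ! i) - int (z ! i))\<^sup>2) = 0" using n by simp
    hence xz: "x ! i = z ! i" if "i < m" for i using that by (simp add: sum_nonneg_eq_0_iff)
    have "y = x"
    proof (rule nth_equalityI)
      fix i assume "i < length y"
      hence "i < m" using E by (simp add: E_def)
      thus "y ! i = x ! i" using mid xz by fastforce
    qed (use E in \<open>simp add: E_def\<close>)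
    hence "d = replicate m 0"
      using vadd_eq_self_iff[of p x m d] E_Fpn E(1) d(1) p by (auto simp: y_def)
    thus False using d by simp
  qed
  thus ?thesis using r E_Fpn by (intro exI[of _ ?B]) auto
qed

text \<open>The bound is homogeneous: scaling the indicator of \<open>A\<close> by c multiplies both
  sides by c^3. Hence a set of density at least alpha yields a function of mean exactly
  alpha.\<close>

definition ap_sparse :: "nat \<Rightarrow> nat \<Rightarrow> real \<Rightarrow> nat list set \<Rightarrow> bool" where
  "ap_sparse p n \<beta> A \<longleftrightarrow> A \<subseteq> Fpn p n \<and> (\<forall>d\<in>Fpn p n. d \<noteq> replicate n 0 \<longrightarrow>
     real (card (aps p A d)) / real p ^ n < \<beta> * dens p n A ^ 3)"

lemma mv_translate_cancel:
  assumes "0 < p" "C \<in> mats p m N" "y \<in> Fpn p N" "z \<in> Fpn p N" "d \<in> Fpn p N"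
    and "mv p m C (vadd p y d) = mv p m C (vadd p z d)"
  shows "mv p m C y = mv p m C z"
proof (rule vadd_left_cancel)
  show "mv p m C d \<in> Fpn p m" "mv p m C y \<in> Fpn p m" "mv p m C z \<in> Fpn p m"
    using assms(1,2) by (auto intro: mv_closed)
  show "vadd p (mv p m C d) (mv p m C y) = vadd p (mv p m C d) (mv p m C z)"
    using assms(6) mv_add[OF assms(1-3,5)] mv_add[OF assms(1,2,4,5)]
    by (metis vadd_commute)
qed

text \<open>No fibre exceeds the kernel, and the hypothesis on the kernel makes these upper bounds
  add up to exactly \<open>p ^ N\<close>. So every fibre attains its bound.\<close>

lemma card_preimage:
  assumes p: "0 < p" and v: "v x \<in> mats p m N"
    and ker: "card (ker p m N v {x}) * p ^ m = p ^ N" and B: "B \<subseteq> Fpn p m"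
  shows "card {y \<in> Fpn p N. mv p m (v x) y \<in> B} * p ^ m = card B * p ^ N"
proof -
  let ?K = "card (ker p m N v {x})"
  let ?f = "\<lambda>b. card {y \<in> Fpn p N. mv p m (v x) y = b}"
  have le: "?f b \<le> ?K" for b
    by (rule card_fibre_le_ker[OF p]) (use v in auto)
  have split: "card {y \<in> Fpn p N. mv p m (v x) y \<in> D} = (\<Sum>b\<in>D. ?f b)" if "D \<subseteq> Fpn p m" for D
  proof -
    have "finite D" using that finite_subset finite_Fpn by blast
    moreover have "{y \<in> Fpn p N. mv p m (v x) y \<in> D} = (\<Union>b\<in>D. {y \<in> Fpn p N. mv p m (v x) y = b})"
      by auto
    ultimately show ?thesis by (simp only:) (rule card_UN_disjoint; auto)
  qed
  have "{y \<in> Fpn p N. mv p m (v x) y \<in> Fpn p m} = Fpn p N"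
    using mv_closed[OF p v] by auto
  hence "(\<Sum>b\<in>Fpn p m. ?f b) = (\<Sum>b\<in>Fpn p m. ?K)"
    using split[of "Fpn p m"] ker by (simp add: mult.commute)
  hence eq: "?f b = ?K" if "b \<in> Fpn p m" for b
    by (rule sum_mono_inv) (use le that in auto)
  have "card {y \<in> Fpn p N. mv p m (v x) y \<in> B} = (\<Sum>b\<in>B. ?K)"
    unfolding split[OF B] by (rule sum.cong) (use eq B in auto)
  thus ?thesis using ker by simp
qed

text \<open>The set splits according to the three values in \<open>B\<close>. After cancelling the
  shifts \<open>d\<close> and \<open>e\<close>, all three maps are constant on each piece, so a
  piece is no larger than the joint kernel.\<close>

lemma card_triple_preimage:
  assumes p: "0 < p" and v: "v x1 \<in> mats p m N" "v x2 \<in> mats p m N" "v x3 \<in> mats p m N"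
    and ker: "card (ker p m N v {x1, x2, x3}) * p ^ (m * 3) = p ^ N"
    and B: "finite B" and d: "d \<in> Fpn p N" "e \<in> Fpn p N"
  shows "card {y \<in> Fpn p N. mv p m (v x1) y \<in> B \<and> mv p m (v x2) (vadd p y d) \<in> B \<and>
           mv p m (v x3) (vadd p y e) \<in> B} * p ^ (m * 3) \<le> card B ^ 3 * p ^ N"
proof -
  let ?K = "card (ker p m N v {x1, x2, x3})"
  let ?F = "\<lambda>(a, b, c). {y \<in> Fpn p N. mv p m (v x1) y = a \<and> mv p m (v x2) (vadd p y d) = b \<and>
     mv p m (v x3) (vadd p y e) = c}"
  let ?S = "{y \<in> Fpn p N. mv p m (v x1) y \<in> B \<and> mv p m (v x2) (vadd p y d) \<in> B \<and>
           mv p m (v x3) (vadd p y e) \<in> B}"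
  have le: "card (?F t) \<le> ?K" for t
  proof (cases t)
    case (fields a b c)
    show ?thesis unfolding fields prod.case
    proof (rule card_fibre_le_ker[OF p])
      fix x y z
      assume x: "x \<in> {x1, x2, x3}" and y: "y \<in> {y \<in> Fpn p N. mv p m (v x1) y = a \<and>
          mv p m (v x2) (vadd p y d) = b \<and> mv p m (v x3) (vadd p y e) = c}"
        and z: "z \<in> {y \<in> Fpn p N. mv p m (v x1) y = a \<and>
          mv p m (v x2) (vadd p y d) = b \<and> mv p m (v x3) (vadd p y e) = c}"
      have "mv p m (v x1) y = mv p m (v x1) z" using y z by simp
      moreover have "mv p m (v x2) y = mv p m (v x2) z"
        by (rule mv_translate_cancel[OF p v(2) _ _ d(1)]) (use y z in auto)
      moreover have "mv p m (v x3) y = mv p m (v x3) z"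
        by (rule mv_translate_cancel[OF p v(3) _ _ d(2)]) (use y z in auto)
      ultimately show "mv p m (v x) y = mv p m (v x) z" using x by auto
    qed (use v in auto)
  qed
  have "?S = (\<Union>t\<in>B \<times> B \<times> B. ?F t)" by auto
  hence "card ?S \<le> (\<Sum>t\<in>B \<times> B \<times> B. card (?F t))"
    using card_UN_le[of "B \<times> B \<times> B" ?F] B by simp
  also have "\<dots> \<le> (\<Sum>t\<in>B \<times> B \<times> B. ?K)" by (rule sum_mono) (rule le)
  also have "\<dots> = card B ^ 3 * ?K" by (simp add: card_cartesian_product power3_eq_cube)
  finally have "card ?S * p ^ (m * 3) \<le> card B ^ 3 * ?K * p ^ (m * 3)" by (rule mult_le_mono1)
  thus ?thesis using ker by (simp add: mult.assoc)
qed

text \<open>The new set consists of all \<open>x @ y\<close> with \<open>x \<in> A\<close> and \<open>v x\<close> mapping \<open>y\<close> into \<open>B\<close>. A difference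
  that is nonzero on the first block keeps its relative count, by the joint surjectivity of three of the
  maps. A difference supported on the second block only sees those \<open>x\<close> for which \<open>v x\<close> kills it,
  because \<open>B\<close> has no progressions.\<close>

lemma ap_sparse_extend:
  assumes p: "prime p" "odd p" and A: "ap_sparse p n \<beta> A" "A \<noteq> {}"
    and B: "B \<subseteq> Fpn p m" "B \<noteq> {}" "\<And>d. d \<in> Fpn p m \<Longrightarrow> d \<noteq> replicate m 0 \<Longrightarrow> aps p B d = {}"
    and \<beta>: "4 / real p ^ m \<le> \<beta> * (dens p n A * dens p m B)\<^sup>2"
    and small: "real (card A) ^ 3 * real p ^ (m * 3) / real p ^ N
       + real p ^ N * (1 + 1 / real p ^ m) ^ card A * 2 powr (- (4 * real (card A) / real p ^ m)) < 1"
  shows "\<exists>A'. ap_sparse p (n + N) \<beta> A' \<and> dens p (n + N) A' = dens p n A * dens p m B"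
proof -
  have p0: "0 < p" "1 < p" using p prime_gt_0_nat prime_gt_1_nat by blast+
  have rp: "0 < real p" using p0 by simp
  have AF: "A \<subseteq> Fpn p n" using A by (simp add: ap_sparse_def)
  have fA: "finite A" and fB: "finite B" using AF B finite_subset finite_Fpn by blast+
  \<comment> \<open>Repetitions are allowed, so the family contains the singletons, which make each
    single map surjective, as well as the three-point sets.\<close>
  define \<F> where "\<F> = (\<lambda>(a, b, c). {a, b, c}) ` (A \<times> A \<times> A)"
  have fF: "finite \<F>" unfolding \<F>_def using fA by simp
  have FA: "S \<subseteq> A" if "S \<in> \<F>" for S using that by (auto simp: \<F>_def)
  have "card \<F> \<le> card (A \<times> A \<times> A)" unfolding \<F>_def using fA by (intro card_image_le) simp
  hence cF: "real (card \<F>) \<le> real (card A) ^ 3"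
    unfolding of_nat_power[symmetric] of_nat_le_iff by (simp add: card_cartesian_product power3_eq_cube)
  have "(\<Sum>S\<in>\<F>. real p ^ (m * card S)) \<le> (\<Sum>S\<in>\<F>. real p ^ (m * 3))"
  proof (rule sum_mono)
    fix S assume "S \<in> \<F>"
    then obtain a b c where "S = {a, b, c}" by (auto simp: \<F>_def)
    hence "card S \<le> 3" using card_length[of "[a, b, c]"] by simp
    thus "real p ^ (m * card S) \<le> real p ^ (m * 3)" using p0 by (intro power_increasing) auto
  qed
  also have "\<dots> \<le> real (card A) ^ 3 * real p ^ (m * 3)" using cF by (simp add: mult_right_mono)
  finally have "(\<Sum>S\<in>\<F>. real p ^ (m * card S)) / real p ^ N
      \<le> real (card A) ^ 3 * real p ^ (m * 3) / real p ^ N" using rp by (simp add: divide_right_mono)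
  hence "(\<Sum>S\<in>\<F>. real p ^ (m * card S)) / real p ^ N
       + real p ^ N * (1 + 1 / real p ^ m) ^ card A * 2 powr (- (4 * real (card A) / real p ^ m)) < 1"
    using small by linarith
  from exists_good_matrices[OF p(1) fA fF FA this]
  obtain v where v: "v \<in> PiE A (\<lambda>_. mats p m N)"
    and vF: "\<And>S. S \<in> \<F> \<Longrightarrow> card (ker p m N v S) * p ^ (m * card S) = p ^ N"
    and vZ: "\<And>y. y \<in> Fpn p N \<Longrightarrow> y \<noteq> replicate N 0 \<Longrightarrow>
        real (card {x \<in> A. mv p m (v x) y = replicate m 0}) < 4 * real (card A) / real p ^ m"
    by blast
  have vx: "v x \<in> mats p m N" if "x \<in> A" for x using v that by (auto simp: PiE_iff)
  define G where "G = (\<lambda>x. {y \<in> Fpn p N. mv p m (v x) y \<in> B})"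
  define A' where "A' = (\<lambda>(x, y). x @ y) ` Sigma A G"
  have inj: "inj_on (\<lambda>(x, y). x @ y) (Sigma (Fpn p n) G')" for G' :: "nat list \<Rightarrow> nat list set"
    by (auto simp: inj_on_def Fpn_length)
  have A'F: "A' \<subseteq> Fpn p (n + N)"
    using AF by (auto simp: A'_def G_def intro!: append_in_Fpn)
  have mem: "x @ y \<in> A' \<longleftrightarrow> x \<in> A \<and> y \<in> G x" if "x \<in> Fpn p n" for x y
    using that AF by (auto simp: A'_def image_iff Fpn_length subset_iff)
  have cG: "card (G x) * p ^ m = card B * p ^ N" if x: "x \<in> A" for x
  proof -
    have "{x} \<in> \<F>" unfolding \<F>_def using x by force
    hence "card (ker p m N v {x}) * p ^ m = p ^ N" using vF[of "{x}"] by simp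
    thus ?thesis unfolding G_def by (intro card_preimage p0 vx x B)
  qed
  have cG': "real (card (G x)) = dens p m B * real p ^ N" if x: "x \<in> A" for x
    using arg_cong[OF cG[OF x], of real] rp by (simp add: dens_def field_simps)
  have cS: "card ((\<lambda>(x, y). x @ y) ` Sigma S H) = (\<Sum>x\<in>S. card (H x))"
    if "S \<subseteq> A" "\<And>x. x \<in> S \<Longrightarrow> finite (H x)" for S H
  proof -
    have "inj_on (\<lambda>(x, y). x @ y) (Sigma S H)"
      by (rule inj_on_subset[OF inj[of H]]) (use that AF in auto)
    hence "card ((\<lambda>(x, y). x @ y) ` Sigma S H) = card (Sigma S H)" by (rule card_image)
    also have "\<dots> = (\<Sum>x\<in>S. card (H x))"
      using that fA finite_subset by (intro card_SigmaI) blast+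
    finally show ?thesis .
  qed
  have "real (card A') = (\<Sum>x\<in>A. real (card (G x)))"
    unfolding A'_def by (subst cS) (auto simp: G_def)
  also have "\<dots> = real (card A) * (dens p m B * real p ^ N)" by (simp add: cG')
  finally have dA': "dens p (n + N) A' = dens p n A * dens p m B"
    using rp by (simp add: dens_def power_add)
  have posA: "0 < dens p n A" and posB: "0 < dens p m B"
    using A(2) B(2) fA fB rp by (auto simp: dens_def card_gt_0_iff)
  have main: "real (card (aps p A' d)) / real p ^ (n + N) < \<beta> * (dens p n A * dens p m B) ^ 3"
    if d: "d \<in> Fpn p (n + N)" "d \<noteq> replicate (n + N) 0" for d
  proof -
    obtain d1 d2 where d12: "d = d1 @ d2" "d1 \<in> Fpn p n" "d2 \<in> Fpn p N"
      using Fpn_appendE[OF d(1)] by blast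
    define H where "H = (\<lambda>x. {y \<in> Fpn p N. mv p m (v x) y \<in> B \<and>
       mv p m (v (vadd p x d1)) (vadd p y d2) \<in> B \<and>
       mv p m (v (vadd p x (vadd p d1 d1))) (vadd p y (vadd p d2 d2)) \<in> B})"
    have sub: "aps p A' d \<subseteq> (\<lambda>(x, y). x @ y) ` Sigma (aps p A d1) H"
    proof
      fix z assume z: "z \<in> aps p A' d"
      hence "z \<in> A'" by (simp add: aps_def)
      then obtain x y where xy: "z = x @ y" "x \<in> A" "y \<in> G x" by (auto simp: A'_def)
      have l: "length x = length d1" "length d1 = length d1" "length y = length d2"
        using xy AF d12 by (auto simp: Fpn_length G_def subset_iff)
      have xF: "x \<in> Fpn p n" using xy AF by blast
      have yF: "y \<in> Fpn p N" using xy by (simp add: G_def)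
      have "vadd p x d1 @ vadd p y d2 \<in> A'"
        "vadd p x (vadd p d1 d1) @ vadd p y (vadd p d2 d2) \<in> A'"
        using z l unfolding aps_def xy(1) d12(1) by (auto simp: vadd_append)
      hence m1: "vadd p x d1 \<in> A" "vadd p y d2 \<in> G (vadd p x d1)"
        and m2: "vadd p x (vadd p d1 d1) \<in> A" "vadd p y (vadd p d2 d2) \<in> G (vadd p x (vadd p d1 d1))"
        using mem xF d12 p0 by auto
      have "x \<in> aps p A d1" using xy m1 m2 by (simp add: aps_def)
      moreover have "y \<in> H x" using xy m1 m2 by (simp add: H_def G_def)
      ultimately show "z \<in> (\<lambda>(x, y). x @ y) ` Sigma (aps p A d1) H" using xy by force
    qed
    have apsA: "aps p A d1 \<subseteq> A" by (auto simp: aps_def)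
    have fH: "finite (H x)" for x by (simp add: H_def)
    have fapsA: "finite (aps p A d1)" using apsA fA finite_subset by blast
    have "card (aps p A' d) \<le> card ((\<lambda>(x, y). x @ y) ` Sigma (aps p A d1) H)"
      by (rule card_mono[OF _ sub]) (use fapsA fH in auto)
    also have "\<dots> = (\<Sum>x\<in>aps p A d1. card (H x))" by (rule cS[OF apsA fH])
    finally have "real (card (aps p A' d)) \<le> real (\<Sum>x\<in>aps p A d1. card (H x))" by (rule of_nat_mono)
    hence le: "real (card (aps p A' d)) \<le> (\<Sum>x\<in>aps p A d1. real (card (H x)))" by simp
    show ?thesis
    proof (cases "d1 = replicate n 0")
      case False
      have Hle: "real (card (H x)) \<le> dens p m B ^ 3 * real p ^ N" if x: "x \<in> aps p A d1" for x
      proof -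
        let ?x2 = "vadd p x d1" and ?x3 = "vadd p x (vadd p d1 d1)"
        have xA: "x \<in> A" "?x2 \<in> A" "?x3 \<in> A" using x by (auto simp: aps_def)
        have xF: "x \<in> Fpn p n" "?x2 \<in> Fpn p n" using xA AF by auto
        have dd: "vadd p d1 d1 \<in> Fpn p n" using d12 p0 by simp
        have "?x2 \<noteq> x" using vadd_eq_self_iff[OF p0(1) xF(1) d12(2)] False by simp
        moreover have "?x3 \<noteq> x"
          using vadd_eq_self_iff[OF p0(1) xF(1) dd] vadd_double_eq_zero_iff[OF p(2) d12(2)] False
          by simp
        moreover have "?x3 \<noteq> ?x2"
          using vadd_eq_self_iff[OF p0(1) xF(2) d12(2)] False by (simp add: vadd_assoc)
        \<comment> \<open>Three distinct indices give the full exponent \<open>m * 3\<close>, that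
          is, joint surjectivity.\<close>
        ultimately have c3: "card {x, ?x2, ?x3} = 3" by auto
        have "{x, ?x2, ?x3} \<in> \<F>" unfolding \<F>_def using xA by force
        from vF[OF this] have "card (ker p m N v {x, ?x2, ?x3}) * p ^ (m * 3) = p ^ N"
          unfolding c3 .
        from card_triple_preimage[OF p0(1) vx[OF xA(1)] vx[OF xA(2)] vx[OF xA(3)] this fB d12(3)]
        have "card (H x) * p ^ (m * 3) \<le> card B ^ 3 * p ^ N"
          unfolding H_def using d12 p0 by simp
        hence "real (card (H x) * p ^ (m * 3)) \<le> real (card B ^ 3 * p ^ N)" by (rule of_nat_mono)
        hence "real (card (H x)) \<le> real (card B) ^ 3 * real p ^ N / real p ^ (m * 3)"
          using rp by (simp add: pos_le_divide_eq)
        thus ?thesis by (simp add: dens_def power_divide power_mult)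
      qed
      have "real (card (aps p A' d)) \<le> (\<Sum>x\<in>aps p A d1. dens p m B ^ 3 * real p ^ N)"
        by (rule order_trans[OF le sum_mono]) (rule Hle)
      hence "real (card (aps p A' d)) / real p ^ (n + N)
          \<le> (real (card (aps p A d1)) / real p ^ n) * dens p m B ^ 3"
        using rp by (simp add: power_add field_simps)
      also have "\<dots> < (\<beta> * dens p n A ^ 3) * dens p m B ^ 3"
        using A(1) d12(2) False posB by (intro mult_strict_right_mono) (auto simp: ap_sparse_def)
      finally show ?thesis by (simp add: power_mult_distrib mult.assoc)
    next
      case True
      have d2: "d2 \<noteq> replicate N 0" using d d12 True by (auto simp: replicate_add)
      have x1: "vadd p x d1 = x" "vadd p x (vadd p d1 d1) = x" if "x \<in> A" for x
        using that AF True vadd_zero_right[of x p n] vadd_zero[of "replicate n 0" p n] p0 by auto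
      have apsA': "aps p A d1 = A" unfolding True by (rule aps_zero[OF p0(1) AF])
      let ?Z = "{x \<in> A. mv p m (v x) d2 = replicate m 0}"
      \<comment> \<open>Otherwise the images of the three points under \<open>v x\<close> would form
        a progression in \<open>B\<close> with nonzero difference
        \<open>mv p m (v x) d2\<close>.\<close>
      have H0: "H x = {}" if x: "x \<in> A" "x \<notin> ?Z" for x
      proof (rule ccontr)
        assume "H x \<noteq> {}"
        then obtain y where y: "y \<in> H x" by blast
        let ?e = "mv p m (v x) d2" and ?b = "mv p m (v x) y"
        have yF: "y \<in> Fpn p N" using y by (simp add: H_def)
        have "mv p m (v x) (vadd p y d2) = vadd p ?b ?e"
          "mv p m (v x) (vadd p y (vadd p d2 d2)) = vadd p ?b (vadd p ?e ?e)"
          using mv_add[OF p0(1) vx[OF x(1)]] yF d12(3) p0 by simp_all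
        hence "?b \<in> aps p B ?e" using y x1[OF x(1)] by (simp add: H_def aps_def)
        moreover have "aps p B ?e = {}"
          using B(3)[OF mv_closed[OF p0(1) vx[OF x(1)]]] x by simp
        ultimately show False by simp
      qed
      have H1: "real (card (H x)) \<le> dens p m B * real p ^ N" if x: "x \<in> A" for x
      proof -
        have "card (H x) \<le> card (G x)" by (rule card_mono) (auto simp: H_def G_def)
        thus ?thesis using cG'[OF x] by simp
      qed
      have "(\<Sum>x\<in>A. real (card (H x))) = (\<Sum>x\<in>?Z. real (card (H x)))"
        by (rule sum.mono_neutral_right[OF fA]) (use H0 in auto)
      also have "\<dots> \<le> (\<Sum>x\<in>?Z. dens p m B * real p ^ N)" by (rule sum_mono) (use H1 in auto)
      also have "\<dots> = real (card ?Z) * (dens p m B * real p ^ N)" by simp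
      also have "\<dots> < 4 * real (card A) / real p ^ m * (dens p m B * real p ^ N)"
        using vZ[OF d12(3) d2] posB rp by (intro mult_strict_right_mono) auto
      finally have "real (card (aps p A' d)) < 4 * real (card A) / real p ^ m * (dens p m B * real p ^ N)"
        using le unfolding apsA' by linarith
      hence "real (card (aps p A' d)) / real p ^ (n + N)
          < 4 * real (card A) / real p ^ m * (dens p m B * real p ^ N) / real p ^ (n + N)"
        by (rule divide_strict_right_mono) (use rp in simp)
      also have "\<dots> = 4 / real p ^ m * (dens p n A * dens p m B)"
        using rp by (simp add: dens_def power_add)
      also have "\<dots> \<le> \<beta> * (dens p n A * dens p m B)\<^sup>2 * (dens p n A * dens p m B)"
        using \<beta> posA posB by (intro mult_right_mono) auto
      finally show ?thesis by (simp add: power2_eq_square power3_eq_cube mult.assoc)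
    qed
  qed
  have "ap_sparse p (n + N) \<beta> A'"
    unfolding ap_sparse_def dA' using A'F main by blast
  thus ?thesis using dA' by blast
qed

subsection \<open>Numerical estimates\<close>

text \<open>The factor 30000 lets a new dimension 2^j or p^h dominate both the old dimensions and
  100 times the bound on the density exponent.\<close>

lemma linear_le_two_power: "20 \<le> h \<Longrightarrow> 30000 * h \<le> (2::nat) ^ h"
proof (induction h rule: nat_induct_at_least)
  case (Suc h)
  have "30000 * Suc h \<le> 2 * (30000 * h)" using Suc.hyps by simp
  also have "\<dots> \<le> 2 * 2 ^ h" using Suc.IH by simp
  finally show ?case by simp
qed simp

lemma two_powr_ge_half: "x / 2 \<le> 2 powr (x::real)"
proof -
  have "1 / 2 \<le> ln (2::real)" using ln_add_one_self_le_self2[of "- 1 / 2"] by (simp add: ln_div)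
  hence "x / 2 \<le> x * ln 2 \<or> x < 0" using mult_left_mono[of "1 / 2" "ln 2" x] by auto
  moreover have "1 + x * ln 2 \<le> 2 powr x" using exp_ge_add_one_self by (simp add: powr_def)
  moreover have "x / 2 \<le> 2 powr x" if "x < 0" using that powr_ge_zero[of 2 x] by linarith
  ultimately show ?thesis by linarith
qed

text \<open>Fourth power of the preceding bound at r = x / 8000, where r^3 >= 128000. It pays for
  the factor m lost by pigeonholing over spheres.\<close>

lemma le_two_powr_div_2000:
  assumes "500000 \<le> (x::real)"
  shows "x \<le> 2 powr (x / 2000)"
proof -
  define r where "r = x / 8000"
  have r: "60 \<le> r" using assms by (simp add: r_def)
  have "128000 \<le> (60::real) ^ 3" by simp
  also have "\<dots> \<le> r ^ 3" using r by (intro power_mono) auto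
  finally have "128000 * r \<le> r ^ 3 * r" using r by (intro mult_right_mono) auto
  hence "8000 * r \<le> (r / 2) ^ 4" by (simp add: power_divide eval_nat_numeral)
  also have "\<dots> \<le> (2 powr r) ^ 4" using two_powr_ge_half[of r] r by (intro power_mono) auto
  also have "\<dots> = 2 powr (x / 2000)" by (simp add: powr_power r_def)
  finally show ?thesis by (simp add: r_def)
qed

text \<open>The caps of \<open>exists_cap\<close> in dimension \<open>m\<close> have density about \<open>2 powr (- theta p * m)\<close>.\<close>

definition theta :: "nat \<Rightarrow> real" where
  "theta p = 1 + log 2 (real p) - log 2 (real p + 1)"

text \<open>Reduces a logarithmic bound to rational arithmetic: \<open>r\<close> is the slack
  between the two powers, and \<open>r ^ b\<close> against \<open>2 ^ a\<close> measures that slack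
  in bits.\<close>

lemma log2_diff_ge:
  assumes "r * y ^ e \<le> x ^ d" "(2::real) ^ a \<le> r ^ b" "0 < x" "0 < y" "0 < r" "0 < b"
  shows "real a / real b \<le> real d * log 2 x - real e * log 2 y"
proof -
  have "log 2 (2 ^ a) \<le> log 2 (r ^ b)" using assms by (subst log_le_cancel_iff) auto
  hence "real a \<le> real b * log 2 r" using assms by (simp add: log_nat_power)
  hence "real a / real b \<le> log 2 r" using assms by (simp add: divide_le_eq mult.commute)
  moreover have "log 2 (r * y ^ e) \<le> log 2 (x ^ d)"
    using assms by (subst log_le_cancel_iff) auto
  hence "log 2 r + real e * log 2 y \<le> real d * log 2 x"
    using assms by (simp add: log_nat_power log_mult)
  ultimately show ?thesis by linarith
qed

text \<open>Expanding in t = p - 19, the two sides of (p/19)^4 <= ((p+1)/20)^5 compare coefficient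
  by coefficient. This reduces the bounds below to p = 19, because 5/4 is less than both 32/25 and
  9/7.\<close>

lemma log_ratio_le:
  assumes "19 \<le> p"
  shows "4 * (log 2 (real p) - log 2 19) \<le> 5 * (log 2 (real p + 1) - log 2 20)"
    and "0 \<le> log 2 (real p + 1) - log 2 20"
proof -
  define t where "t = real p - 19"
  have t: "0 \<le> t" "real p = 19 + t" using assms by (simp_all add: t_def)
  have "(real p / 19) ^ 4 \<le> ((real p + 1) / 20) ^ 5"
  proof -
    have "((20 + t) / 20) ^ 5 = 1 + t/4 + t^2/40 + t^3/800 + t^4/32000 + t^5/3200000"
      by (simp add: eval_nat_numeral field_simps)
    moreover have "((19 + t) / 19) ^ 4 = 1 + 4*t/19 + 6*t^2/361 + 4*t^3/6859 + t^4/130321"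
      by (simp add: eval_nat_numeral field_simps)
    moreover have "4*t/19 \<le> t/4" "6*t^2/361 \<le> t^2/40" "4*t^3/6859 \<le> t^3/800"
      "t^4/130321 \<le> t^4/32000" "0 \<le> t^5/3200000"
      using t by (auto simp: field_simps)
    ultimately have "((19 + t) / 19) ^ 4 \<le> ((20 + t) / 20) ^ 5" by linarith
    thus ?thesis unfolding t(2) by (simp add: algebra_simps)
  qed
  hence "log 2 ((real p / 19) ^ 4) \<le> log 2 (((real p + 1) / 20) ^ 5)"
    using assms by (subst log_le_cancel_iff) auto
  thus "4 * (log 2 (real p) - log 2 19) \<le> 5 * (log 2 (real p + 1) - log 2 20)"
    using assms by (simp add: log_nat_power log_divide)
  show "0 \<le> log 2 (real p + 1) - log 2 20" using assms by simp
qed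

text \<open>The last two bounds make the first extension step possible, from dimension \<open>9 k\<close> with values
  in dimension \<open>7 k\<close>. They express \<open>10 ^ 32 > 19 ^ 25\<close> and \<open>10 ^ 9 > 19 ^ 7\<close>, and are the reason
  for the hypothesis \<open>p \<ge> 19\<close>.\<close>

lemma log_bounds:
  assumes "19 \<le> p"
  shows "21 / 5 \<le> log 2 (real p)" "theta p \<le> 1"
    "1 / 12 \<le> 7 * log 2 (real p) - 32 * theta p"
    "3 / 20 \<le> 2 * log 2 (real p) - 9 * theta p"
proof -
  have l20: "log 2 (20::real) = 1 + log 2 10"
    using log_mult[of 2 10 "2::real"] by simp
  have "21 / 5 \<le> log 2 (19::real)"
    using log2_diff_ge[of 19 1 0 19 1 21 5] by simp
  also have "\<dots> \<le> log 2 (real p)" using assms by simp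
  finally show "21 / 5 \<le> log 2 (real p)" .
  show "theta p \<le> 1" using assms by (simp add: theta_def)
  \<comment> \<open>The slack 107/100 satisfies (107/100) 19^25 <= 10^32 and (107/100)^12 >=
    2.\<close>
  have "1 / 12 \<le> 32 * log 2 10 - 25 * log 2 (19::real)"
    using log2_diff_ge[of "107 / 100" 19 25 10 32 1 12] by (simp add: power_divide)
  thus "1 / 12 \<le> 7 * log 2 (real p) - 32 * theta p"
    using log_ratio_le[OF assms] l20 by (simp add: theta_def)
  have "3 / 20 \<le> 9 * log 2 10 - 7 * log 2 (19::real)"
    using log2_diff_ge[of "111 / 100" 19 7 10 9 3 20] by (simp add: power_divide)
  thus "3 / 20 \<le> 2 * log 2 (real p) - 9 * theta p"
    using log_ratio_le[OF assms] l20 by (simp add: theta_def)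
qed

lemma power_eq_two_powr:
  assumes "0 < p"
  shows "real p ^ k = 2 powr (real k * log 2 (real p))"
proof -
  have "2 powr (real k * log 2 (real p)) = (2 powr log 2 (real p)) powr real k"
    by (simp only: powr_powr mult.commute)
  also have "\<dots> = real p ^ k" using assms by (simp add: powr_realpow)
  finally show ?thesis ..
qed

text \<open>The digit box has density ((q+1)/p)^m = 2^(-theta m). Restricting to one sphere costs a
  factor m q^2 + 1 <= m p^2, and m and p^2 are each at most 2^(m/2000); this is where the two lower
  bounds on \<open>m\<close> enter.\<close>

lemma exists_dense_cap:
  assumes p: "odd p" "19 \<le> p" and m: "500000 \<le> m" "8000 * log 2 (real p) \<le> real m"
  shows "\<exists>B \<subseteq> Fpn p m. (\<forall>d\<in>Fpn p m. d \<noteq> replicate m 0 \<longrightarrow> aps p B d = {}) \<and>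
     2 powr (- ((theta p + 1 / 1000) * real m)) \<le> dens p m B"
proof -
  obtain q where q: "p = 2 * q + 1" using p(1) by (elim oddE)
  obtain B where B: "B \<subseteq> Fpn p m" "\<forall>d\<in>Fpn p m. d \<noteq> replicate m 0 \<longrightarrow> aps p B d = {}"
    and card: "(q + 1) ^ m \<le> card B * (m * q\<^sup>2 + 1)"
    using exists_cap[OF q, of m] by blast
  have rp: "0 < real p" using p by simp
  have "2 powr (- ((theta p + 1 / 1000) * real m))
      = 2 powr (- theta p * real m) / 2 powr (real m / 1000)"
    by (simp add: powr_diff[symmetric] algebra_simps)
  also have "2 powr (- theta p * real m) = (2 powr (- theta p)) ^ m"
    by (simp add: powr_power mult.commute)
  also have "2 powr (- theta p) = (real q + 1) / real p"
  proof -
    have "2 powr (- theta p) = 2 powr (log 2 (real p + 1)) / (2 powr 1 * 2 powr (log 2 (real p)))"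
      unfolding powr_add[symmetric] powr_diff[symmetric] by (simp add: theta_def)
    also have "\<dots> = (real p + 1) / (2 * real p)" using rp by simp
    also have "real p + 1 = 2 * (real q + 1)" by (simp add: q)
    also have "2 * (real q + 1) / (2 * real p) = (real q + 1) / real p"
      by (rule mult_divide_mult_cancel_left) simp
    finally show ?thesis .
  qed
  also have "((real q + 1) / real p) ^ m / 2 powr (real m / 1000)
      \<le> ((real q + 1) / real p) ^ m / (real m * (real q)\<^sup>2 + 1)"
  proof (intro divide_left_mono mult_pos_pos)
    have "real m * (real q)\<^sup>2 + 1 \<le> real m * (real p)\<^sup>2"
    proof -
      have "(real q)\<^sup>2 + 1 \<le> (real p)\<^sup>2" by (simp add: q power2_eq_square algebra_simps)
      hence "real m * ((real q)\<^sup>2 + 1) \<le> real m * (real p)\<^sup>2" by (intro mult_left_mono) auto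
      moreover have "1 \<le> real m" using m by simp
      ultimately show ?thesis by (simp add: algebra_simps)
    qed
    also have "\<dots> \<le> 2 powr (real m / 2000) * 2 powr (2 * log 2 (real p))"
    proof (intro mult_mono)
      show "real m \<le> 2 powr (real m / 2000)" using m by (intro le_two_powr_div_2000) simp
      show "(real p)\<^sup>2 \<le> 2 powr (2 * log 2 (real p))"
        using power_eq_two_powr[of p 2] rp by simp
    qed auto
    also have "\<dots> \<le> 2 powr (real m / 1000)"
      unfolding powr_add[symmetric] using m by (intro powr_mono) auto
    finally show "real m * (real q)\<^sup>2 + 1 \<le> 2 powr (real m / 1000)" .
  qed (use rp in \<open>auto intro!: add_nonneg_pos\<close>)
  also have "\<dots> \<le> dens p m B"
  proof -
    have "real ((q + 1) ^ m) \<le> real (card B * (m * q\<^sup>2 + 1))" using card by (rule of_nat_mono)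
    hence "(real q + 1) ^ m \<le> real (card B) * (real m * (real q)\<^sup>2 + 1)"
      by (simp add: algebra_simps)
    moreover have "0 < real m * (real q)\<^sup>2 + 1" by (auto intro!: add_nonneg_pos)
    ultimately have "(real q + 1) ^ m / (real m * (real q)\<^sup>2 + 1) \<le> real (card B)"
      by (simp add: pos_divide_le_eq)
    hence "(real q + 1) ^ m / (real m * (real q)\<^sup>2 + 1) / real p ^ m \<le> real (card B) / real p ^ m"
      by (rule divide_right_mono) simp
    thus ?thesis by (simp add: dens_def power_divide mult.commute)
  qed
  finally show ?thesis using B by blast
qed

text \<open>Each summand is at most 1/2, the second strictly less. The +1 in the bound on
  \<open>N\<close> supplies a spare factor p >= 2 for the first. For the second, let s = M / p^m be
  the mean number of zeros: the moment is at most e^s <= 2^(8s/5), and the threshold 4s leaves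
  2^(-12s/5) against the p^N vectors.\<close>

lemma good_matrices_condition:
  assumes p: "2 \<le> p" and M: "real M \<le> real p ^ n" and N: "3 * n + 3 * m + 1 \<le> N"
    and s: "real N * log 2 (real p) + 1 < 12 / 5 * (real M / real p ^ m)"
  shows "real M ^ 3 * real p ^ (m * 3) / real p ^ N
       + real p ^ N * (1 + 1 / real p ^ m) ^ M * 2 powr (- (4 * real M / real p ^ m)) < 1"
proof -
  define s where "s = real M / real p ^ m"
  have rp: "2 \<le> real p" "0 < real p" using p by auto
  have s0: "0 \<le> s" by (simp add: s_def)
  have "real M ^ 3 * real p ^ (m * 3) * real p \<le> (real p ^ n) ^ 3 * real p ^ (m * 3) * real p"
    using M by (intro mult_right_mono power_mono) auto
  also have "\<dots> = real p ^ (3 * n + 3 * m + 1)" by (simp add: power_add power_mult[symmetric] mult.commute)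
  also have "\<dots> \<le> real p ^ N" using N rp by (intro power_increasing) auto
  finally have "real M ^ 3 * real p ^ (m * 3) * 2 \<le> real p ^ N"
    using rp by (intro order_trans[OF mult_left_mono[of 2 "real p"]]) auto
  hence first: "real M ^ 3 * real p ^ (m * 3) / real p ^ N \<le> 1 / 2"
    using rp by (simp add: divide_le_eq)
  \<comment> \<open>e^5 <= 3^5 = 243 < 256 = 2^8.\<close>
  have ln2: "1 \<le> 8 / 5 * ln (2::real)"
  proof -
    have "exp 1 ^ 5 \<le> (3::real) ^ 5" using exp_le by (intro power_mono) auto
    hence "ln (exp 1 ^ 5) \<le> ln ((2::real) ^ 8)" by (subst ln_le_cancel_iff) auto
    thus ?thesis by (simp add: ln_realpow del: power_numeral)
  qed
  have "(1 + 1 / real p ^ m) ^ M \<le> exp (1 / real p ^ m) ^ M"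
    using exp_ge_add_one_self[of "1 / real p ^ m"] by (intro power_mono) auto
  also have "\<dots> = exp s" by (simp add: exp_of_nat_mult[symmetric] s_def)
  also have "\<dots> \<le> exp (8 / 5 * s * ln 2)"
  proof -
    have "s * 1 \<le> s * (8 / 5 * ln 2)" using ln2 s0 by (intro mult_left_mono) auto
    thus ?thesis by (simp add: mult_ac)
  qed
  also have "\<dots> = 2 powr (8 / 5 * s)" by (simp add: powr_def)
  finally have "real p ^ N * (1 + 1 / real p ^ m) ^ M * 2 powr (- (4 * s))
      \<le> real p ^ N * 2 powr (8 / 5 * s) * 2 powr (- (4 * s))"
    by (intro mult_right_mono mult_left_mono) auto
  also have "\<dots> = 2 powr (real N * log 2 (real p) + 8 / 5 * s + (- (4 * s)))"
    using rp unfolding powr_add by (simp add: power_eq_two_powr)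
  also have "\<dots> < 2 powr (- 1)" using s unfolding s_def[symmetric] by (intro powr_less_mono) auto
  finally have "real p ^ N * (1 + 1 / real p ^ m) ^ M * 2 powr (- (4 * s)) < 1 / 2"
    by (simp add: powr_minus_divide)
  thus ?thesis using first unfolding s_def times_divide_eq_right by linarith
qed

subsection \<open>Iteration\<close>

text \<open>The density is only bounded below, so \<open>L\<close> may be enlarged to a convenient
  closed form after each step.\<close>

definition sparse_dim :: "nat \<Rightarrow> real \<Rightarrow> nat \<Rightarrow> real \<Rightarrow> bool" where
  "sparse_dim p \<beta> n L \<longleftrightarrow> (\<exists>A. ap_sparse p n \<beta> A \<and> 2 powr (- L) \<le> dens p n A)"

lemma dens_pos_nonempty: "0 < dens p n A \<Longrightarrow> A \<noteq> {}"
  by (auto simp: dens_def)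

text \<open>The extension step in logarithmic form. The condition on \<open>m\<close> encodes 4 p^-m
  <= beta 2^(-2(L+K)); the last one compares N log p with p^(n-m) 2^-L, a lower bound for the mean
  number of zeros.\<close>

lemma sparse_dim_extend:
  assumes p: "prime p" "odd p" and n: "ap_sparse p n \<beta> A" "2 powr (- L) \<le> dens p n A"
    and B: "B \<subseteq> Fpn p m" "\<forall>d\<in>Fpn p m. d \<noteq> replicate m 0 \<longrightarrow> aps p B d = {}"
    and dB: "2 powr (- K) \<le> dens p m B"
    and \<beta>: "0 < \<beta>" "log 2 (1 / \<beta>) + 2 + 2 * (L + K) \<le> real m * log 2 (real p)"
    and N: "3 * n + 3 * m + 1 \<le> N"
    and s: "real N * log 2 (real p) + 1 < 12 / 5 * 2 powr ((real n - real m) * log 2 (real p) - L)"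
  shows "sparse_dim p \<beta> (n + N) (L + K)"
proof -
  have p0: "2 \<le> p" "0 < p" using p(1) prime_ge_2_nat prime_gt_0_nat by blast+
  have dA0: "0 < dens p n A" and dB0: "0 < dens p m B"
    using n(2) dB powr_gt_zero[of 2 "- L"] powr_gt_zero[of 2 "- K"] by linarith+
  have dAB: "2 powr (- (L + K)) \<le> dens p n A * dens p m B"
  proof -
    have "2 powr (- (L + K)) = 2 powr (- L) * 2 powr (- K)" by (simp flip: powr_add)
    also have "\<dots> \<le> dens p n A * dens p m B" using n(2) dB dA0 by (intro mult_mono) auto
    finally show ?thesis .
  qed
  have AF: "A \<subseteq> Fpn p n" using n(1) by (simp add: ap_sparse_def)
  have cA: "real (card A) = dens p n A * real p ^ n" using p0 by (simp add: dens_def)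
  have "real (card A) \<le> real (card (Fpn p n))" using AF by (intro of_nat_mono card_mono) auto
  hence M: "real (card A) \<le> real p ^ n" by simp
  have "2 powr ((real n - real m) * log 2 (real p) - L)
      = 2 powr (- L) * 2 powr (real n * log 2 (real p)) / 2 powr (real m * log 2 (real p))"
    unfolding powr_add[symmetric] powr_diff[symmetric] by (simp add: algebra_simps)
  also have "\<dots> = 2 powr (- L) * real p ^ n / real p ^ m"
    using p0 by (simp add: power_eq_two_powr)
  also have "\<dots> \<le> real (card A) / real p ^ m"
    unfolding cA using n(2) by (intro divide_right_mono mult_right_mono) auto
  finally have "real N * log 2 (real p) + 1 < 12 / 5 * (real (card A) / real p ^ m)"
    using s by linarith
  note small = good_matrices_condition[OF p0(1) M N this]
  have "4 / real p ^ m = 2 powr 2 / 2 powr (real m * log 2 (real p))"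
    using p0 by (simp add: power_eq_two_powr)
  also have "\<dots> = 2 powr (2 - real m * log 2 (real p))" by (rule powr_diff[symmetric])
  also have "\<dots> \<le> 2 powr (log 2 \<beta> + 2 * (- (L + K)))"
    using \<beta> by (intro powr_mono) (auto simp: log_divide)
  also have "\<dots> = \<beta> * (2 powr (- (L + K)))\<^sup>2"
    using \<beta>(1) by (simp add: powr_add powr_power)
  also have "\<dots> \<le> \<beta> * (dens p n A * dens p m B)\<^sup>2"
    using \<beta>(1) dAB by (intro mult_left_mono power_mono) auto
  finally have cond: "4 / real p ^ m \<le> \<beta> * (dens p n A * dens p m B)\<^sup>2" .
  obtain A' where "ap_sparse p (n + N) \<beta> A'" "dens p (n + N) A' = dens p n A * dens p m B"
    using ap_sparse_extend[OF p n(1) dens_pos_nonempty[OF dA0] B(1) dens_pos_nonempty[OF dB0] _ cond small] B(2)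
    by blast
  thus ?thesis using dAB unfolding sparse_dim_def by auto
qed

text \<open>A cap has no progressions at all, so it can start the recursion. Used alone in a
  dimension above 1/beta it would be too thin. Instead a cap in dimension 90 j, with j about 100
  log(1/beta), is extended once by one in dimension 70 j with N = 2^j, at a density exponent linear
  in log(1/beta).\<close>

lemma sparse_dim_base:
  assumes p: "prime p" "19 \<le> p" and \<beta>: "0 < \<beta>"
    and L\<beta>: "100 * log 2 (real p) \<le> log 2 (1 / \<beta>)"
  shows "\<exists>n. sparse_dim p \<beta> n (21000 * log 2 (1 / \<beta>)) \<and> 2 * (1 / \<beta>) + 3 \<le> real n \<and>
     100 * (21000 * log 2 (1 / \<beta>)) \<le> real n"
proof -
  have podd: "odd p" using p prime_odd_nat by auto
  define l where "l = log 2 (real p)"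
  define b where "b = log 2 (1 / \<beta>)"
  define K where "K = theta p + 1 / 1000"
  define j where "j = nat \<lceil>100 * b\<rceil>"
  note lb = log_bounds[OF p(2), folded l_def]
  have b: "100 * l \<le> b" "420 \<le> b" using L\<beta> lb(1) by (simp_all add: l_def b_def)
  have j: "100 * b \<le> real j" "real j \<le> 100 * b + 1" using b unfolding j_def by linarith+
  have j': "42000 \<le> real j" "10000 * l \<le> real j" using b j by linarith+
  have K: "K \<le> 1001 / 1000" using lb(2) by (simp add: K_def)
  obtain A where A: "A \<subseteq> Fpn p (90 * j)"
      "\<forall>d\<in>Fpn p (90 * j). d \<noteq> replicate (90 * j) 0 \<longrightarrow> aps p A d = {}"
      "2 powr (- ((theta p + 1 / 1000) * real (90 * j))) \<le> dens p (90 * j) A"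
    using exists_dense_cap[OF podd p(2), of "90 * j"] j' by (auto simp: l_def)
  obtain B where B: "B \<subseteq> Fpn p (70 * j)"
      "\<forall>d\<in>Fpn p (70 * j). d \<noteq> replicate (70 * j) 0 \<longrightarrow> aps p B d = {}"
      "2 powr (- ((theta p + 1 / 1000) * real (70 * j))) \<le> dens p (70 * j) B"
    using exists_dense_cap[OF podd p(2), of "70 * j"] j' by (auto simp: l_def)
  have dA: "2 powr (- (K * (90 * real j))) \<le> dens p (90 * j) A" using A(3) by (simp add: K_def)
  have dB: "2 powr (- (K * (70 * real j))) \<le> dens p (70 * j) B" using B(3) by (simp add: K_def)
  have "0 < dens p (90 * j) A" 
    using dA powr_gt_zero[of 2 "- (K * (90 * real j))"] by linarith
  hence spA: "ap_sparse p (90 * j) \<beta> A" unfolding ap_sparse_def using A \<beta> by simp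
  have "20 \<le> j" using j'(1) by linarith
  hence pow: "30000 * j \<le> 2 ^ j" by (rule linear_le_two_power)
  have pow': "real (2 ^ j) = 2 powr real j" by (simp add: powr_realpow)
  have dim: "sparse_dim p \<beta> (90 * j + 2 ^ j) (K * (90 * real j) + K * (70 * real j))"
  proof (rule sparse_dim_extend[OF p(1) podd spA dA B(1,2) dB \<beta>])
    show "3 * (90 * j) + 3 * (70 * j) + 1 \<le> 2 ^ j" using pow \<open>20 \<le> j\<close> by linarith
    \<comment> \<open>70 l - 320 K + 32/100 is 10 (7 l - 32 theta) >= 5/6. The surplus (5/6 -
      32/100) j covers log(1/beta) + 2, since j >= 100 log(1/beta).\<close>
    have "real j * 1 \<le> real j * (70 * l - 320 * K + 32 / 100 - 5 / 6 + 1)"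
      using lb(3) by (intro mult_left_mono) (auto simp: K_def)
    hence "320 * (K * real j) + (5 / 6 - 32 / 100) * real j \<le> 70 * (real j * l)"
      by (simp add: algebra_simps)
    thus "log 2 (1 / \<beta>) + 2 + 2 * (K * (90 * real j) + K * (70 * real j))
        \<le> real (70 * j) * log 2 (real p)"
      unfolding l_def[symmetric] b_def[symmetric] using j b by (simp add: mult.assoc)
    \<comment> \<open>Likewise 20 l - 90 K + 9/100 is 10 (2 l - 9 theta) >= 3/2. Of the resulting
      exponent 1.41 j, one j pays for N = 2^j and the rest for the factor l + 1.\<close>
    have "real j * (3 / 2) \<le> real j * (20 * l - 90 * K + 9 / 100)"
      using lb(4) by (intro mult_left_mono) (auto simp: K_def)
    hence expo: "real j + 41 / 100 * real j \<le> (real (90 * j) - real (70 * j)) * l - K * (90 * real j)"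
      by (simp add: algebra_simps)
    have "l + 1 \<le> (41 / 100 * real j) / 2" using j' lb(1) by linarith
    also have "\<dots> \<le> 2 powr (41 / 100 * real j)" by (rule two_powr_ge_half)
    finally have "2 powr real j * (l + 1) \<le> 2 powr real j * 2 powr (41 / 100 * real j)"
      by (intro mult_left_mono) auto
    also have "\<dots> \<le> 2 powr ((real (90 * j) - real (70 * j)) * l - K * (90 * real j))"
      unfolding powr_add[symmetric] using expo by (intro powr_mono) auto
    finally have e: "real (2 ^ j) * (l + 1) \<le> 2 powr ((real (90 * j) - real (70 * j)) * l - K * (90 * real j))"
      unfolding pow' .
    have "1 \<le> real (2 ^ j)" by simp
    hence "real (2 ^ j) * l + 1 \<le> real (2 ^ j) * (l + 1)" by (simp add: distrib_left)
    also have "\<dots> < 12 / 5 * (real (2 ^ j) * (l + 1))" using lb(1) by simp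
    finally show "real (2 ^ j) * log 2 (real p) + 1
        < 12 / 5 * 2 powr ((real (90 * j) - real (70 * j)) * log 2 (real p) - K * (90 * real j))"
      using e unfolding l_def by linarith
  qed
  have "K * (90 * real j) + K * (70 * real j) = K * (160 * real j)" by simp
  also have "\<dots> \<le> 1001 / 1000 * (160 * real j)" using K by (intro mult_right_mono) auto
  also have "\<dots> \<le> 21000 * b" using j b by linarith
  finally have "- (21000 * b) \<le> - (K * (90 * real j) + K * (70 * real j))" by simp
  hence "2 powr (- (21000 * b)) \<le> 2 powr (- (K * (90 * real j) + K * (70 * real j)))"
    by (intro powr_mono) auto
  hence "sparse_dim p \<beta> (90 * j + 2 ^ j) (21000 * b)"
    using dim unfolding sparse_dim_def by (meson order_trans)
  moreover have "2 * (1 / \<beta>) + 3 \<le> real (90 * j + 2 ^ j)"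
  proof -
    have "2 * (1 / \<beta>) = 2 powr (1 + b)" using \<beta> by (simp add: powr_add b_def)
    also have "\<dots> \<le> 2 powr real j" using j b by (intro powr_mono) auto
    finally show ?thesis using pow' j' by simp
  qed
  moreover have "100 * (21000 * b) \<le> real (90 * j + 2 ^ j)"
  proof -
    have "real (30000 * j) \<le> real (2 ^ j)" using pow by (rule of_nat_mono)
    thus ?thesis using j by simp
  qed
  ultimately show ?thesis unfolding b_def by blast
qed

text \<open>With m about 4 L / l, the product m l = 4L pays for 2L, for twice the cap exponent, and
  for log(1/beta) + 2. Choosing N = p^h with h about n/2 leaves the other half of the exponent for m
  and L. The hypothesis on (log p)^2 ensures that \<open>m\<close> is large enough against log p for
  a dense cap.\<close>

lemma sparse_dim_step:
  assumes p: "prime p" "19 \<le> p" and \<beta>: "0 < \<beta>"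
    and L\<beta>: "(log 2 (real p))\<^sup>2 \<le> log 2 (1 / \<beta>)" "100 * log 2 (real p) \<le> log 2 (1 / \<beta>)"
    and L: "21000 * log 2 (1 / \<beta>) \<le> L" and n: "sparse_dim p \<beta> n L" "100 * L \<le> real n"
    and T: "0 \<le> T" "2 * T + 3 \<le> real n"
  shows "\<exists>n'. sparse_dim p \<beta> n' (L * (1 + 5 / log 2 (real p))) \<and>
     2 * real p powr T + 3 \<le> real n' \<and> 100 * (L * (1 + 5 / log 2 (real p))) \<le> real n'"
proof -
  have podd: "odd p" using p prime_odd_nat by auto
  have rp: "19 \<le> real p" using p by simp
  define l where "l = log 2 (real p)"
  define b where "b = log 2 (1 / \<beta>)"
  define K where "K = theta p + 1 / 1000"
  define x where "x = 4 * L / l"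
  define m where "m = nat \<lceil>x\<rceil>"
  define h where "h = n div 2"
  note lb = log_bounds[OF p(2), folded l_def]
  have b: "100 * l \<le> b" "420 \<le> b" "l\<^sup>2 \<le> b" using L\<beta> lb(1) by (simp_all add: l_def b_def)
  have K: "K \<le> 1001 / 1000" using lb(2) by (simp add: K_def)
  have Lb: "21000 * b \<le> L" using L by (simp add: b_def)
  have xl: "x * l = 4 * L" using lb(1) by (simp add: x_def)
  have x1: "8000000 \<le> x"
  proof -
    have "8000000 * l \<le> x * l" unfolding xl using Lb b lb(1) by linarith
    thus ?thesis using lb(1) by (simp add: mult_le_cancel_right)
  qed
  have x2: "80000 * l \<le> x"
  proof -
    have "80000 * l * l \<le> x * l" unfolding xl using Lb b lb(1) by (simp add: power2_eq_square)
    thus ?thesis using lb(1) by (simp add: mult_le_cancel_right)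
  qed
  have x3: "x \<le> 20 / 21 * L"
  proof -
    have "x * (21 / 5) \<le> x * l" using lb(1) x1 by (intro mult_left_mono) auto
    thus ?thesis unfolding xl by simp
  qed
  have m: "x \<le> real m" "real m \<le> x + 1" using x1 unfolding m_def by linarith+
  have mL: "real m \<le> L" using m x3 Lb b by linarith
  have h: "2 * real h \<le> real n" "real n \<le> 2 * real h + 1"
    unfolding h_def by linarith+
  have nL: "100 * L \<le> real n" and L0: "8000000 \<le> L" using n Lb b by linarith+
  have hL: "49 * L \<le> real h" using h nL L0 by linarith
  have "20 \<le> h" using hL L0 by linarith
  hence "30000 * h \<le> 2 ^ h" by (rule linear_le_two_power)
  also have "(2::nat) ^ h \<le> p ^ h" using p by (intro power_mono) auto
  finally have "real (30000 * h) \<le> real (p ^ h)" by (rule of_nat_mono)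
  hence pow: "30000 * real h \<le> real (p ^ h)" by simp
  have pow': "real (p ^ h) = 2 powr (real h * l)" using rp by (simp add: power_eq_two_powr l_def)
  obtain A where A: "ap_sparse p n \<beta> A" "2 powr (- L) \<le> dens p n A"
    using n(1) unfolding sparse_dim_def by blast
  obtain B where B: "B \<subseteq> Fpn p m"
      "\<forall>d\<in>Fpn p m. d \<noteq> replicate m 0 \<longrightarrow> aps p B d = {}"
      "2 powr (- ((theta p + 1 / 1000) * real m)) \<le> dens p m B"
  proof -
    have "500000 \<le> m" "8000 * log 2 (real p) \<le> real m"
      using m x1 x2 lb(1) unfolding l_def[symmetric] by linarith+
    thus ?thesis using exists_dense_cap[OF podd p(2), of m] that by blast
  qed
  have dB: "2 powr (- (K * real m)) \<le> dens p m B" using B(3) by (simp add: K_def)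
  have Km: "K * real m \<le> 1001 / 1000 * real m" using K by (intro mult_right_mono) auto
  have dim: "sparse_dim p \<beta> (n + p ^ h) (L + K * real m)"
  proof (rule sparse_dim_extend[OF p(1) podd A B(1,2) dB \<beta>])
    have "real (3 * n + 3 * m + 1) \<le> real (p ^ h)" using pow h mL hL L0 by simp
    thus "3 * n + 3 * m + 1 \<le> p ^ h" by (simp only: of_nat_le_iff)
    \<comment> \<open>2002/1000 is twice the bound on \<open>K\<close>. As l exceeds it, rounding 4
      L / l up to \<open>m\<close> only helps.\<close>
    have "x * (l - 2002 / 1000) \<le> real m * (l - 2002 / 1000)"
      using m lb(1) by (intro mult_right_mono) auto
    hence "4 * L - 2002 / 1000 * x \<le> real m * l - 2002 / 1000 * real m"
      using xl by (simp add: algebra_simps)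
    moreover have "2 * (L + K * real m) \<le> 2 * L + 2002 / 1000 * real m" using Km by simp
    moreover have "b + 2 + 2002 / 1000 * x \<le> 2 * L" using x3 Lb b by simp
    ultimately show "log 2 (1 / \<beta>) + 2 + 2 * (L + K * real m) \<le> real m * log 2 (real p)"
      unfolding l_def[symmetric] b_def[symmetric] by simp
    have e1: "real h * l + L \<le> (real n - real m) * l - L"
    proof -
      have "2 * L * 1 \<le> 2 * L * l" using lb(1) L0 by (intro mult_left_mono) auto
      also have "\<dots> \<le> (real n - real m - real h) * l"
        using lb(1) h nL mL L0 by (intro mult_right_mono) auto
      finally show ?thesis by (simp add: algebra_simps)
    qed
    have "l + 1 \<le> L / 2" using Lb b lb(1) by linarith
    also have "\<dots> \<le> 2 powr L" by (rule two_powr_ge_half)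
    finally have "2 powr (real h * l) * (l + 1) \<le> 2 powr (real h * l) * 2 powr L"
      by (intro mult_left_mono) auto
    also have "\<dots> \<le> 2 powr ((real n - real m) * l - L)"
      unfolding powr_add[symmetric] using e1 by (intro powr_mono) auto
    finally have e: "real (p ^ h) * (l + 1) \<le> 2 powr ((real n - real m) * l - L)"
      unfolding pow' .
    have "1 \<le> real (p ^ h)" using pow hL L0 by linarith
    hence pos: "0 < real (p ^ h) * (l + 1)" using lb(1) by (intro mult_pos_pos) linarith+
    have "real (p ^ h) * l + 1 \<le> real (p ^ h) * (l + 1)"
      using \<open>1 \<le> real (p ^ h)\<close> by (simp add: distrib_left)
    also have "\<dots> < 12 / 5 * (real (p ^ h) * (l + 1))" using pos by linarith
    finally show "real (p ^ h) * log 2 (real p) + 1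
        < 12 / 5 * 2 powr ((real n - real m) * log 2 (real p) - L)"
      using e unfolding l_def by linarith
  qed
  \<comment> \<open>The coefficient 5/4 leaves room above the cap cost of at most 1.001 (x + 1),
    including the rounding of \<open>m\<close>.\<close>
  have LL: "L * (1 + 5 / l) = L + 5 / 4 * x" by (simp add: x_def algebra_simps)
  have "L + K * real m \<le> L * (1 + 5 / l)" unfolding LL using Km m x1 by linarith
  hence "2 powr (- (L * (1 + 5 / l))) \<le> 2 powr (- (L + K * real m))" by (intro powr_mono) auto
  hence "sparse_dim p \<beta> (n + p ^ h) (L * (1 + 5 / l))"
    using dim unfolding sparse_dim_def by (meson order_trans)
  moreover have "2 * real p powr T + 3 \<le> real (n + p ^ h)"
  proof -
    have T1: "1 \<le> real p powr T" using T rp by (simp add: ge_one_powr_ge_zero)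
    \<comment> \<open>The form 2 T + 3 survives halving: h >= T + 1 gives p^h >= 19 p^T >= 2 p^T +
      3.\<close>
    have "T + 1 \<le> real h" using T h by linarith
    hence "real p powr (T + 1) \<le> real p powr real h" using rp by (intro powr_mono) auto
    hence "real p powr T * real p \<le> real (p ^ h)" using rp by (simp add: powr_add powr_realpow)
    moreover have "real p powr T * 19 \<le> real p powr T * real p" using rp by (intro mult_left_mono) auto
    ultimately show ?thesis using T1 by simp
  qed
  moreover have "100 * (L * (1 + 5 / l)) \<le> real (n + p ^ h)"
    unfolding LL using pow hL x3 L0 by simp
  ultimately show ?thesis unfolding l_def by blast
qed

section \<open>Tower growth of the dimension, and the passage from sets to functions\<close>

lemma Tow_ge_1: "1 \<le> a \<Longrightarrow> 1 \<le> r \<Longrightarrow> 1 \<le> Tow a k r"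
  by (induction k) (auto simp: ge_one_powr_ge_zero)

lemma sparse_dim_tower:
  assumes p: "prime p" "19 \<le> p" and \<beta>: "0 < \<beta>"
    and L\<beta>: "(log 2 (real p))\<^sup>2 \<le> log 2 (1 / \<beta>)" "100 * log 2 (real p) \<le> log 2 (1 / \<beta>)"
  shows "\<exists>n. sparse_dim p \<beta> n (21000 * log 2 (1 / \<beta>) * (1 + 5 / log 2 (real p)) ^ k) \<and>
     2 * Tow (real p) k (1 / \<beta>) + 3 \<le> real n \<and>
     100 * (21000 * log 2 (1 / \<beta>) * (1 + 5 / log 2 (real p)) ^ k) \<le> real n"
proof (induction k)
  case 0
  show ?case using sparse_dim_base[OF p \<beta> L\<beta>(2)] by simp
next
  case (Suc k)
  have l: "0 < log 2 (real p)" using log_bounds(1)[OF p(2)] by linarith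
  have b: "0 < log 2 (1 / \<beta>)" using l L\<beta> by linarith
  hence "1 \<le> 1 / \<beta>" using \<beta> by (simp add: zero_less_log_cancel_iff)
  hence T: "0 \<le> Tow (real p) k (1 / \<beta>)" using Tow_ge_1[of "real p" "1 / \<beta>" k] p by simp
  let ?L = "21000 * log 2 (1 / \<beta>) * (1 + 5 / log 2 (real p)) ^ k"
  have "1 \<le> (1 + 5 / log 2 (real p)) ^ k" using l by (intro one_le_power) simp
  hence L: "21000 * log 2 (1 / \<beta>) \<le> ?L" using b by simp
  from Suc.IH obtain n where n: "sparse_dim p \<beta> n ?L" "2 * Tow (real p) k (1 / \<beta>) + 3 \<le> real n"
    "100 * ?L \<le> real n" by blast
  show ?case using sparse_dim_step[OF p \<beta> L\<beta> L n(1,3) T n(2)] by (simp add: mult_ac)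
qed

lemma avg_indicator_aps:
  assumes "0 < p" "A \<subseteq> Fpn p n" "d \<in> Fpn p n"
  shows "avg p n (\<lambda>x. (if x \<in> A then c else 0) * (if vadd p x d \<in> A then c else 0) *
       (if vadd p x (vadd p d d) \<in> A then c else 0))
    = c ^ 3 * (real (card (aps p A d)) / real p ^ n)"
proof -
  have "(\<Sum>x\<in>Fpn p n. (if x \<in> A then c else 0) * (if vadd p x d \<in> A then c else 0) *
       (if vadd p x (vadd p d d) \<in> A then c else 0)) = (\<Sum>x\<in>Fpn p n. if x \<in> aps p A d then c ^ 3 else 0)"
    by (intro sum.cong refl) (auto simp: aps_def power3_eq_cube)
  also have "\<dots> = (\<Sum>x\<in>Fpn p n \<inter> aps p A d. c ^ 3)"
    by (simp only: sum.inter_restrict[OF finite_Fpn])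
  also have "Fpn p n \<inter> aps p A d = aps p A d" using assms(2) by (auto simp: aps_def)
  finally show ?thesis by (simp add: avg_def)
qed

theorem theorem10:
  fixes p :: nat and \<alpha> \<beta> :: real
  assumes "prime p" and "p \<ge> 19"
    and "0 < \<alpha>" and "\<alpha> < 1"
    and "\<alpha> powr (exp (-132)) \<le> \<beta>"
    and "\<beta> \<le> min ((real p) powr (- log 2 (real p))) ((real p) powr (-100))"
  shows "\<exists>n::nat. \<exists>f :: nat list \<Rightarrow> real.
     real n \<ge> TowR (real p)
        ((1/20) * log 2 (real p) * ln (log 2 (1/\<alpha>) / log 2 (1/\<beta>))) (1/\<beta>)
   \<and> (\<forall>x\<in>Fpn p n. 0 \<le> f x \<and> f x \<le> 1)
   \<and> avg p n f = \<alpha>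
   \<and> (\<forall>d\<in>Fpn p n. d \<noteq> replicate n 0 \<longrightarrow>
        avg p n (\<lambda>x. f x * f (vadd p x d) * f (vadd p x (vadd p d d))) < \<beta> * \<alpha> ^ 3)"
proof -
  define l where "l = log 2 (real p)"
  define b where "b = log 2 (1 / \<beta>)"
  define a where "a = log 2 (1 / \<alpha>)"
  define R where "R = ln (a / b)"
  define k where "k = nat \<lfloor>(1/20) * l * R\<rfloor>"
  have rp: "19 \<le> real p" using assms by simp
  have l: "21 / 5 \<le> l" unfolding l_def using log_bounds(1) assms by blast
  have \<beta>0: "0 < \<beta>" 
    using assms(3,5) powr_gt_zero[of \<alpha> "exp (- 132)"] by linarith
  have logb: "b = - log 2 \<beta>" using \<beta>0 by (simp add: b_def log_divide)
  have loga: "a = - log 2 \<alpha>" using assms(3) by (simp add: a_def log_divide)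
  have "log 2 \<beta> \<le> log 2 (real p powr (- log 2 (real p)))"
    using assms(6) \<beta>0 rp by (subst log_le_cancel_iff) auto
  hence b1: "l\<^sup>2 \<le> b" using rp by (simp add: logb l_def log_powr power2_eq_square)
  have "log 2 \<beta> \<le> log 2 (real p powr (- 100))"
    using assms(6) \<beta>0 rp by (subst log_le_cancel_iff) auto
  hence b2: "100 * l \<le> b" using rp by (simp add: logb l_def log_powr)
  have b0: "0 < b" using b2 l by linarith
  have "log 2 (\<alpha> powr (exp (- 132))) \<le> log 2 \<beta>"
    using assms(3,5) \<beta>0 by (subst log_le_cancel_iff) auto
  hence "b \<le> exp (- 132) * a" using assms(3) by (simp add: logb loga log_powr)
  hence "exp 132 * b \<le> exp 132 * (exp (- 132) * a)" by (intro mult_left_mono) auto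
  also have "\<dots> = a" by (simp flip: exp_add mult.assoc)
  finally have "exp 132 \<le> a / b" using b0 by (simp add: pos_le_divide_eq)
  moreover have ab: "0 < a / b" using \<open>exp 132 \<le> a / b\<close> exp_gt_zero[of 132] by linarith
  ultimately have R: "132 \<le> R" unfolding R_def by (simp add: ln_ge_iff)
  have expR: "exp R = a / b" using ab by (simp add: R_def)
  have k: "real k \<le> (1/20) * l * R" unfolding k_def using l R by (intro of_nat_floor) simp
  obtain n where n: "sparse_dim p \<beta> n (21000 * b * (1 + 5 / l) ^ k)"
      "2 * Tow (real p) k (1 / \<beta>) + 3 \<le> real n"
    using sparse_dim_tower[OF assms(1,2) \<beta>0, of k] b1 b2 unfolding l_def b_def by blast
  \<comment> \<open>The height factor 1/20 times the growth rate 5 bounds the accumulated growth by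
    exp(R/4), a fourth root of a/b.\<close>
  have "(1 + 5 / l) ^ k \<le> exp (5 / l) ^ k"
    using exp_ge_add_one_self l by (intro power_mono) auto
  also have "\<dots> = exp (real k * (5 / l))" by (rule exp_of_nat_mult[symmetric])
  also have "\<dots> \<le> exp (R / 4)"
  proof -
    have "real k * (5 / l) \<le> (1/20) * l * R * (5 / l)" using k l by (intro mult_right_mono) auto
    also have "\<dots> = R / 4" using l by simp
    finally show ?thesis by simp
  qed
  finally have "21000 * b * (1 + 5 / l) ^ k \<le> 21000 * b * exp (R / 4)"
    using b0 by (intro mult_left_mono) auto
  also have "\<dots> \<le> exp (3 / 4 * R) * b * exp (R / 4)"
  proof -
    \<comment> \<open>The remaining factor exp(3R/4) absorbs the initial constant: R >= 132 makes it
      at least e^99 >= 34^3 > 21000.\<close>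
    have "(21000::real) \<le> (1 + 33) ^ 3" by simp
    also have "\<dots> \<le> exp 33 ^ 3" using exp_ge_add_one_self[of 33] by (intro power_mono) auto
    also have "\<dots> = exp 99" by (simp flip: exp_of_nat_mult)
    also have "\<dots> \<le> exp (3 / 4 * R)" using R by simp
    finally show ?thesis using b0 by (intro mult_right_mono) auto
  qed
  also have "\<dots> = exp R * b" by (simp add: mult_ac flip: exp_add)
  also have "\<dots> = a" using b0 by (simp add: expR)
  finally have La: "21000 * b * (1 + 5 / l) ^ k \<le> a" .
  obtain A where A: "ap_sparse p n \<beta> A" "2 powr (- (21000 * b * (1 + 5 / l) ^ k)) \<le> dens p n A"
    using n(1) unfolding sparse_dim_def by blast
  have "\<alpha> = 2 powr (- a)" using assms(3) by (simp add: loga)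
  also have "\<dots> \<le> 2 powr (- (21000 * b * (1 + 5 / l) ^ k))" using La by (intro powr_mono) auto
  finally have \<alpha>: "\<alpha> \<le> dens p n A" using A(2) by linarith
  \<comment> \<open>Scaling by \<open>c\<close> lowers the mean to exactly alpha; c <= 1 keeps the
    values in [0,1].\<close>
  define c where "c = \<alpha> / dens p n A"
  define f where "f = (\<lambda>x. if x \<in> A then c else 0)"
  have d0: "0 < dens p n A" using \<alpha> assms(3) by linarith
  have c: "0 < c" "c \<le> 1" "c * dens p n A = \<alpha>" using \<alpha> assms(3) d0 by (auto simp: c_def)
  have AF: "A \<subseteq> Fpn p n" using A(1) by (simp add: ap_sparse_def)
  have p0: "0 < p" using assms by simp
  have "TowR (real p) ((1/20) * log 2 (real p) * ln (log 2 (1/\<alpha>) / log 2 (1/\<beta>))) (1/\<beta>)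
      = Tow (real p) k (1 / \<beta>)"
    by (simp add: TowR_def k_def R_def l_def a_def b_def)
  also have "\<dots> \<le> real n"
  proof -
    have "1 \<le> 1 / \<beta>" using b0 \<beta>0 unfolding b_def by (simp add: zero_less_log_cancel_iff)
    hence "1 \<le> Tow (real p) k (1 / \<beta>)" using rp by (intro Tow_ge_1) auto
    thus ?thesis using n(2) by linarith
  qed
  finally have "TowR (real p) ((1/20) * log 2 (real p) * ln (log 2 (1/\<alpha>) / log 2 (1/\<beta>))) (1/\<beta>)
      \<le> real n" .
  moreover have "\<forall>x\<in>Fpn p n. 0 \<le> f x \<and> f x \<le> 1" using c by (simp add: f_def)
  moreover have "avg p n f = \<alpha>"
  proof -
    have "(\<Sum>x\<in>Fpn p n. f x) = (\<Sum>x\<in>A. c)"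
      unfolding f_def using AF
      by (subst sum.inter_restrict[symmetric]) (auto simp: Int_absorb1)
    thus ?thesis using c(3) by (simp add: avg_def dens_def mult.commute)
  qed
  moreover have "avg p n (\<lambda>x. f x * f (vadd p x d) * f (vadd p x (vadd p d d))) < \<beta> * \<alpha> ^ 3"
    if d: "d \<in> Fpn p n" "d \<noteq> replicate n 0" for d
  proof -
    have "real (card (aps p A d)) / real p ^ n < \<beta> * dens p n A ^ 3"
      using A(1) d by (simp add: ap_sparse_def)
    hence "c ^ 3 * (real (card (aps p A d)) / real p ^ n) < c ^ 3 * (\<beta> * dens p n A ^ 3)"
      using c(1) by (intro mult_strict_left_mono) auto
    also have "\<dots> = \<beta> * \<alpha> ^ 3" unfolding c(3)[symmetric] by (simp add: power_mult_distrib)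
    finally show ?thesis unfolding f_def avg_indicator_aps[OF p0 AF d(1)] .
  qed
  ultimately show ?thesis by blast
qed

end
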